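(* Let $X$ be a Banach space, let $t_0<t_1$ be real numbers, let $0<\alpha\le 1$ and let $n\in\mathbb{N}$. Then $$C^{n+\alpha}([t_0,t_1];X)\subset H^{n,\alpha}([t_0,t_1];X).$$
   Context: $\mathbb{N}=\{0,1,2,\ldots\}$. $[\gamma]$ denotes the smallest integer greater than or equal to $\gamma$. For $\gamma>0$, $J_{t_0,t}^{\gamma}f(t)=\frac{1}{\Gamma(\gamma)}\int_{t_0}^{t}(t-s)^{\gamma-1}f(s)\,ds$ (Bochner integral), $J_{t_0,t}^0f=f$. The Riemann–Liouville fractional derivative is $D_{t_0,t}^{\gamma}f(t)=\frac{d^{[\gamma]}}{dt^{[\gamma]}}\big[J_{t_0,t}^{[\gamma]-\gamma}f(t)\big]$ in the weak sense, and the Caputo fractional derivative is $cD_{t_0,t}^{\gamma}f(t)=D_{t_0,t}^{\gamma}\Big[f(t)-\sum_{j=0}^{[\gamma]-1}\frac{f^{(j)}(t_0)}{j!}(t-t_0)^j\Big]$. For $\gamma>0$, $C^{\gamma}([t_0,t_1];X)=\{f\in C^{[\gamma]-1}([t_0,t_1];X): cD_{t_0,t}^{\gamma}f\in C^0([t_0,t_1];X)\}$ (the weak derivative exists and has a continuous representative), where for an integer $k\ge 0$, $C^k$ is the classical space; for $\gamma$ a positive integer this coincides with the classical space. This is NOT the Hölder space. For $n\in\mathbb{N}$ and $\alpha\in(0,1]$, $H^{n,\alpha}([t_0,t_1];X)$ is the space of $n$-times continuously differentiable $f:[t_0,t_1]\to X$ such that $\|f^{(n)}(t)-f^{(n)}(s)\|_X\le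 M|t-s|^{\alpha}$ for all $t,s\in[t_0,t_1]$ and some $M>0$. *)

theory Defs
  imports "HOL-Analysis.Analysis"
begin

section \<open>Bochner integral in an arbitrary Banach space\<close>

text \<open>
  The library's \<^const>\<open>has_bochner_integral\<close> is restricted to second countable codomains, where
  Borel measurability already gives strong measurability. For an arbitrary Banach space strong
  measurability has to be required: the approximating simple functions also converge almost
  everywhere.
\<close>

definition has_bochner :: "'a measure \<Rightarrow> ('a \<Rightarrow> 'b::banach) \<Rightarrow> 'b \<Rightarrow> bool" where
  "has_bochner M f x \<longleftrightarrow>
     (\<exists>s. (\<forall>i. Bochner_Integration.simple_bochner_integrable M (s i)) \<and>
          (AE y in M. (\<lambda>i. s i y) \<longlonglongrightarrow> f y) \<and>
          (\<lambda>i. \<integral>\<^sup>+y. ennreal (norm (f y - s i y)) \<partial>M) \<longlonglongrightarrow> 0 \<and>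
          (\<lambda>i. Bochner_Integration.simple_bochner_integral M (s i)) \<longlonglongrightarrow> x)"

definition bochner_integrable :: "'a measure \<Rightarrow> ('a \<Rightarrow> 'b::banach) \<Rightarrow> bool" where
  "bochner_integrable M f \<longleftrightarrow> (\<exists>x. has_bochner M f x)"

definition bochner_integral :: "'a measure \<Rightarrow> ('a \<Rightarrow> 'b::banach) \<Rightarrow> 'b" where
  "bochner_integral M f = (if bochner_integrable M f then THE x. has_bochner M f x else 0)"


section \<open>Classical and Hoelder spaces on a compact interval\<close>

text \<open>
  Functions on \<open>[a,b]\<close> are total functions on the reals; all notions below depend only on the
  values on \<open>[a,b]\<close>, with one-sided derivatives at the end points.
\<close>

definition iter_deriv :: "real \<Rightarrow> real \<Rightarrow> nat \<Rightarrow> (real \<Rightarrow> 'a::real_normed_vector) \<Rightarrow> real \<Rightarrow> 'a" where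
  "iter_deriv a b k f = ((\<lambda>g t. vector_derivative g (at t within {a..b})) ^^ k) f"

definition C_space :: "nat \<Rightarrow> real \<Rightarrow> real \<Rightarrow> (real \<Rightarrow> 'a::real_normed_vector) set" where
  "C_space k a b =
     {f. (\<forall>j<k. \<forall>t\<in>{a..b}. iter_deriv a b j f differentiable (at t within {a..b})) \<and>
         continuous_on {a..b} (iter_deriv a b k f)}"

definition Hoelder_space ::
    "nat \<Rightarrow> real \<Rightarrow> real \<Rightarrow> real \<Rightarrow> (real \<Rightarrow> 'a::real_normed_vector) set" where
  "Hoelder_space n \<alpha> a b =
     {f. f \<in> C_space n a b \<and>
         (\<exists>M>0. \<forall>t\<in>{a..b}. \<forall>s\<in>{a..b}.
            norm (iter_deriv a b n f t - iter_deriv a b n f s) \<le> M * \<bar>t - s\<bar> powr \<alpha>)}"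


section \<open>Weak derivatives\<close>

definition test_function :: "real \<Rightarrow> real \<Rightarrow> (real \<Rightarrow> real) \<Rightarrow> bool" where
  "test_function a b \<phi> \<longleftrightarrow>
     (\<forall>k x. ((deriv ^^ k) \<phi>) differentiable (at x)) \<and>
     compact (closure {x. \<phi> x \<noteq> 0}) \<and> closure {x. \<phi> x \<noteq> 0} \<subseteq> {a<..<b}"

definition locally_bochner_integrable ::
    "real \<Rightarrow> real \<Rightarrow> (real \<Rightarrow> 'a::banach) \<Rightarrow> bool" where
  "locally_bochner_integrable a b f \<longleftrightarrow>
     (\<forall>c d. a < c \<longrightarrow> d < b \<longrightarrow> bochner_integrable (lebesgue_on {c..d}) f)"

text \<open>\<open>g\<close> is a representative of the \<open>k\<close>-th weak derivative of \<open>u\<close> on \<open>(a,b)\<close>.\<close>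

definition has_weak_deriv ::
    "nat \<Rightarrow> real \<Rightarrow> real \<Rightarrow> (real \<Rightarrow> 'a::banach) \<Rightarrow> (real \<Rightarrow> 'a) \<Rightarrow> bool" where
  "has_weak_deriv k a b u g \<longleftrightarrow>
     locally_bochner_integrable a b u \<and> locally_bochner_integrable a b g \<and>
     (\<forall>\<phi>. test_function a b \<phi> \<longrightarrow>
        bochner_integral (lebesgue_on {a<..<b}) (\<lambda>t. (deriv ^^ k) \<phi> t *\<^sub>R u t) =
        (- 1) ^ k *\<^sub>R bochner_integral (lebesgue_on {a<..<b}) (\<lambda>t. \<phi> t *\<^sub>R g t))"


section \<open>Fractional integrals and derivatives\<close>

definition RL_integral :: "real \<Rightarrow> real \<Rightarrow> (real \<Rightarrow> 'a::banach) \<Rightarrow> real \<Rightarrow> 'a" where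
  "RL_integral t0 \<gamma> f t =
     (if \<gamma> = 0 then f t
      else (1 / Gamma \<gamma>) *\<^sub>R
             bochner_integral (lebesgue_on {t0..t}) (\<lambda>s. (t - s) powr (\<gamma> - 1) *\<^sub>R f s))"

text \<open>
  Weak derivatives are only determined almost everywhere, so the fractional derivatives of order
  \<open>\<gamma>\<close> on \<open>[t0,t1]\<close> are relations between a function and a representative of its derivative.
\<close>

definition has_RL_deriv ::
    "real \<Rightarrow> real \<Rightarrow> real \<Rightarrow> (real \<Rightarrow> 'a::banach) \<Rightarrow> (real \<Rightarrow> 'a) \<Rightarrow> bool" where
  "has_RL_deriv \<gamma> t0 t1 f g \<longleftrightarrow>
     has_weak_deriv (nat \<lceil>\<gamma>\<rceil>) t0 t1 (RL_integral t0 (of_int \<lceil>\<gamma>\<rceil> - \<gamma>) f) g"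

definition has_Caputo_deriv ::
    "real \<Rightarrow> real \<Rightarrow> real \<Rightarrow> (real \<Rightarrow> 'a::banach) \<Rightarrow> (real \<Rightarrow> 'a) \<Rightarrow> bool" where
  "has_Caputo_deriv \<gamma> t0 t1 f g \<longleftrightarrow>
     has_RL_deriv \<gamma> t0 t1
       (\<lambda>t. f t - (\<Sum>j<nat \<lceil>\<gamma>\<rceil>. ((t - t0) ^ j / fact j) *\<^sub>R iter_deriv t0 t1 j f t0)) g"

text \<open>Meant for \<open>\<gamma> > 0\<close> only. This is not the Hoelder space.\<close>

definition frac_C_space :: "real \<Rightarrow> real \<Rightarrow> real \<Rightarrow> (real \<Rightarrow> 'a::banach) set" where
  "frac_C_space \<gamma> t0 t1 =
     {f. f \<in> C_space (nat \<lceil>\<gamma>\<rceil> - 1) t0 t1 \<and>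
         (\<exists>g. continuous_on {t0..t1} g \<and> has_Caputo_deriv \<gamma> t0 t1 f g)}"

end

theory Submission
  imports Defs "HOL-Computational_Algebra.Polynomial"
begin

text \<open>
  Let \<open>w\<close> be \<open>f\<^sup>(\<^sup>n\<^sup>) - f\<^sup>(\<^sup>n\<^sup>)(t0)\<close>, the \<open>n\<close>-th derivative of the Taylor remainder of \<open>f\<close> at
  \<open>t0\<close>. Since \<open>J\<^sup>1\<^sup>-\<^sup>\<alpha>\<close> commutes with \<open>J\<^sup>1\<close> and the lower derivatives of the remainder vanish at
  \<open>t0\<close>, the function \<open>J\<^sup>1\<^sup>-\<^sup>\<alpha> w\<close> has the Caputo derivative \<open>g\<close> of \<open>f\<close> as its first weak
  derivative, hence \<open>J\<^sup>1\<^sup>-\<^sup>\<alpha> w = J\<^sup>1 g\<close> by the lemma of du Bois-Reymond. Applying \<open>J\<^sup>\<alpha>\<close> gives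
  \<open>J\<^sup>1 w = J\<^sup>1 J\<^sup>\<alpha> g\<close>, so \<open>w = J\<^sup>\<alpha> g\<close>, and \<open>J\<^sup>\<alpha>\<close> maps bounded functions to
  \<open>\<alpha>\<close>-Hoelder functions.

  All integrals that occur are Bochner integrals of an integrable scalar function times a
  continuous one. They are Henstock--Kurzweil integrals as well, and the latter are what the
  library supports for functions with values in an arbitrary Banach space.
\<close>

section \<open>Bochner integrals as Henstock--Kurzweil integrals\<close>

text \<open>On one tagged division the Riemann sums of \<open>f\<close> and \<open>g\<close> differ
  by at most the Riemann sum of the majorant \<open>q\<close>, which is close to a small integral.
  Hence the Riemann sums of \<open>f\<close> are Cauchy, and completeness gives the limit.\<close>

lemma integrable_norm_approx_cbox:
  fixes f :: "'n::euclidean_space \<Rightarrow> 'a::banach"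
  assumes approx: "\<And>e. e > 0 \<Longrightarrow> \<exists>g q. g integrable_on cbox a b \<and> q integrable_on cbox a b \<and>
            (\<forall>x\<in>cbox a b. norm (f x - g x) \<le> q x) \<and> integral (cbox a b) q < e"
  shows "f integrable_on cbox a b"
  unfolding integrable_Cauchy
proof (intro allI impI)
  fix e :: real assume "e > 0"
  then obtain g q where g: "g integrable_on cbox a b" and q: "q integrable_on cbox a b"
    and le: "\<And>x. x \<in> cbox a b \<Longrightarrow> norm (f x - g x) \<le> q x" and small: "integral (cbox a b) q < e / 8"
    using approx[of "e / 8"] by auto
  from integrable_integral[OF g, unfolded has_integral, rule_format, of "e / 8"] \<open>e > 0\<close>
  obtain \<gamma>1 where \<gamma>1: "gauge \<gamma>1" "\<And>\<D>. \<D> tagged_division_of cbox a b \<Longrightarrow> \<gamma>1 fine \<D> \<Longrightarrow>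
      norm ((\<Sum>(x, k)\<in>\<D>. measure lborel k *\<^sub>R g x) - integral (cbox a b) g) < e / 8" by auto
  from integrable_integral[OF q, unfolded has_integral, rule_format, of "e / 8"] \<open>e > 0\<close>
  obtain \<gamma>2 where \<gamma>2: "gauge \<gamma>2" "\<And>\<D>. \<D> tagged_division_of cbox a b \<Longrightarrow> \<gamma>2 fine \<D> \<Longrightarrow>
      norm ((\<Sum>(x, k)\<in>\<D>. measure lborel k *\<^sub>R q x) - integral (cbox a b) q) < e / 8" by auto
  \<comment> \<open>Riemann sums of \<open>q\<close> stay below \<open>e / 8 + e / 8\<close>, and
    the approximation of the integral of \<open>g\<close> costs another \<open>e / 8\<close>. Two
    divisions together then stay below \<open>e\<close>.\<close>
  have key: "norm ((\<Sum>(x, k)\<in>\<D>. measure lborel k *\<^sub>R f x) - integral (cbox a b) g) < 3 * e / 8"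
    if D: "\<D> tagged_division_of cbox a b" "(\<lambda>x. \<gamma>1 x \<inter> \<gamma>2 x) fine \<D>" for \<D>
  proof -
    have D1: "\<gamma>1 fine \<D>" and D2: "\<gamma>2 fine \<D>"
      using D(2) by (auto simp: fine_Int)
    have "norm ((\<Sum>(x, k)\<in>\<D>. measure lborel k *\<^sub>R f x) - (\<Sum>(x, k)\<in>\<D>. measure lborel k *\<^sub>R g x))
        = norm (\<Sum>(x, k)\<in>\<D>. measure lborel k *\<^sub>R (f x - g x))"
      by (simp add: sum_subtractf[symmetric] case_prod_unfold scaleR_diff_right)
    also have "\<dots> \<le> (\<Sum>(x, k)\<in>\<D>. measure lborel k *\<^sub>R q x)"
    proof (rule sum_norm_le, clarify)
      fix x K assume "(x, K) \<in> \<D>"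
      then have "x \<in> cbox a b" using D(1) tagged_division_ofD(2,3) by blast
      then show "norm (measure lborel K *\<^sub>R (f x - g x)) \<le> measure lborel K *\<^sub>R q x"
        using le by (simp add: mult_left_mono)
    qed
    finally have "norm ((\<Sum>(x, k)\<in>\<D>. measure lborel k *\<^sub>R f x) - (\<Sum>(x, k)\<in>\<D>. measure lborel k *\<^sub>R g x)) < e / 4"
      using \<gamma>2(2)[OF D(1) D2] small unfolding real_norm_def by linarith
    with \<gamma>1(2)[OF D(1) D1] show ?thesis
      using norm_triangle_ineq[of "(\<Sum>(x, k)\<in>\<D>. measure lborel k *\<^sub>R f x) - (\<Sum>(x, k)\<in>\<D>. measure lborel k *\<^sub>R g x)"
          "(\<Sum>(x, k)\<in>\<D>. measure lborel k *\<^sub>R g x) - integral (cbox a b) g"] by simp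
  qed
  show "\<exists>\<gamma>. gauge \<gamma> \<and> (\<forall>\<D>1 \<D>2. \<D>1 tagged_division_of cbox a b \<and> \<gamma> fine \<D>1 \<and>
          \<D>2 tagged_division_of cbox a b \<and> \<gamma> fine \<D>2 \<longrightarrow>
          norm ((\<Sum>(x, K)\<in>\<D>1. measure lborel K *\<^sub>R f x) - (\<Sum>(x, K)\<in>\<D>2. measure lborel K *\<^sub>R f x)) < e)"
  proof (intro exI[of _ "\<lambda>x. \<gamma>1 x \<inter> \<gamma>2 x"] conjI allI impI)
    show "gauge (\<lambda>x. \<gamma>1 x \<inter> \<gamma>2 x)" using \<gamma>1(1) \<gamma>2(1) by (rule gauge_Int)
    fix \<D>1 \<D>2
    assume "\<D>1 tagged_division_of cbox a b \<and> (\<lambda>x. \<gamma>1 x \<inter> \<gamma>2 x) fine \<D>1 \<and>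
            \<D>2 tagged_division_of cbox a b \<and> (\<lambda>x. \<gamma>1 x \<inter> \<gamma>2 x) fine \<D>2"
    then have "norm ((\<Sum>(x, k)\<in>\<D>1. measure lborel k *\<^sub>R f x) - integral (cbox a b) g) < 3 * e / 8"
        "norm ((\<Sum>(x, k)\<in>\<D>2. measure lborel k *\<^sub>R f x) - integral (cbox a b) g) < 3 * e / 8"
      using key by auto
    then have "norm ((\<Sum>(x, K)\<in>\<D>1. measure lborel K *\<^sub>R f x) - (\<Sum>(x, K)\<in>\<D>2. measure lborel K *\<^sub>R f x)) < 3 * e / 8 + 3 * e / 8"
      by (intro norm_diff_triangle_less[where y="integral (cbox a b) g"]) (simp_all add: norm_minus_commute)
    then show "norm ((\<Sum>(x, K)\<in>\<D>1. measure lborel K *\<^sub>R f x) - (\<Sum>(x, K)\<in>\<D>2. measure lborel K *\<^sub>R f x)) < e"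
      using \<open>e > 0\<close> by simp
  qed
qed

text \<open>Extending \<open>f\<close>, \<open>g\<close> and \<open>q\<close> by zero outside
  \<open>S\<close> preserves the norm bound and reduces the claim to a box.\<close>

lemma integrable_norm_approx:
  fixes f :: "'n::euclidean_space \<Rightarrow> 'a::banach"
  assumes S: "S \<subseteq> cbox a b"
    and approx: "\<And>e. e > 0 \<Longrightarrow> \<exists>g q. g integrable_on S \<and> q integrable_on S \<and>
            (\<forall>x\<in>S. norm (f x - g x) \<le> q x) \<and> integral S q < e"
  shows "f integrable_on S"
proof -
  have "(\<lambda>x. if x \<in> S then f x else 0) integrable_on cbox a b"
  proof (rule integrable_norm_approx_cbox)
    fix e :: real assume "e > 0"
    then obtain g q where gq: "g integrable_on S" "q integrable_on S"
      "\<forall>x\<in>S. norm (f x - g x) \<le> q x" "integral S q < e"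
      using approx by blast
    let ?r = "\<lambda>(h :: 'n \<Rightarrow> _) x. if x \<in> S then h x else 0"
    show "\<exists>g q. g integrable_on cbox a b \<and> q integrable_on cbox a b \<and>
      (\<forall>x\<in>cbox a b. norm ((if x \<in> S then f x else 0) - g x) \<le> q x) \<and> integral (cbox a b) q < e"
      by (rule exI[of _ "\<lambda>x. if x \<in> S then g x else 0"], rule exI[of _ "\<lambda>x. if x \<in> S then q x else 0"])
         (use gq S in \<open>simp add: integrable_restrict_Int Henstock_Kurzweil_Integration.integral_restrict_Int Int_absorb2\<close>)
  qed
  then show ?thesis
    using S by (simp add: integrable_restrict_Int Int_absorb2)
qed

section \<open>Simple functions and their limits in mean\<close>

text \<open>A simple function is the finite sum of its values times the indicators of its level sets
  in \<open>S\<close>, and each level set is Lebesgue measurable with finite measure because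
  \<open>S\<close> is.\<close>

lemma has_integral_simple_bochner:
  fixes s :: "real \<Rightarrow> 'a::banach"
  assumes S: "S \<in> lmeasurable"
    and s: "Bochner_Integration.simple_bochner_integrable (lebesgue_on S) s"
  shows "(s has_integral Bochner_Integration.simple_bochner_integral (lebesgue_on S) s) S"
proof -
  have sf: "simple_function (lebesgue_on S) s"
    using s by (auto elim: Bochner_Integration.simple_bochner_integrable.cases)
  have fin: "finite (s ` S)" using simple_functionD(1)[OF sf] by simp
  have ind: "(indicat_real {x \<in> S. s x = y} has_integral measure (lebesgue_on S) {x \<in> S. s x = y}) S" for y
  proof -
    have "s -` {y} \<inter> space (lebesgue_on S) \<in> sets (lebesgue_on S)"
      using sf by (rule simple_functionD(2))
    moreover have "s -` {y} \<inter> space (lebesgue_on S) = {x \<in> S. s x = y}" by auto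
    ultimately have "{x \<in> S. s x = y} \<in> sets (lebesgue_on S)" by simp
    then have m: "{x \<in> S. s x = y} \<in> sets lebesgue"
      using S by (auto simp: sets_restrict_space_iff fmeasurableD)
    have eq: "measure (lebesgue_on S) {x \<in> S. s x = y} = measure lebesgue {x \<in> S. s x = y}"
      using S by (intro measure_restrict_space) (auto simp: fmeasurableD)
    have lm: "{x \<in> S. s x = y} \<in> lmeasurable"
      by (rule fmeasurableI2[OF S _ m]) auto
    have "(indicat_real {x \<in> S. s x = y} has_integral measure lebesgue {x \<in> S. s x = y}) UNIV"
      using lm by (simp add: lmeasurable_iff_has_integral)
    moreover have "(\<lambda>x. if x \<in> S then indicat_real {x \<in> S. s x = y} x else 0) = indicat_real {x \<in> S. s x = y}"
      by (auto simp: indicator_def)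
    ultimately have "((\<lambda>x. if x \<in> S then indicat_real {x \<in> S. s x = y} x else 0) has_integral measure lebesgue {x \<in> S. s x = y}) UNIV"
      by simp
    then show ?thesis unfolding eq by (subst (asm) has_integral_restrict) auto
  qed
  have "((\<lambda>x. \<Sum>y\<in>s ` S. indicat_real {x \<in> S. s x = y} x *\<^sub>R y) has_integral
      (\<Sum>y\<in>s ` S. measure (lebesgue_on S) {x \<in> S. s x = y} *\<^sub>R y)) S"
    by (intro has_integral_sum fin has_integral_scaleR_left ind)
  then show ?thesis
    unfolding Bochner_Integration.simple_bochner_integral_def space_restrict_space
  proof (subst (asm) has_integral_cong)
    fix x assume x: "x \<in> S"
    have "(\<Sum>y\<in>s ` S. indicat_real {x \<in> S. s x = y} x *\<^sub>R y) = (\<Sum>y\<in>s ` S. if y = s x then s x else 0)"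
      using x by (intro sum.cong) (auto simp: indicator_def)
    then show "(\<Sum>y\<in>s ` S. indicat_real {x \<in> S. s x = y} x *\<^sub>R y) = s x"
      using x fin by (simp add: sum.delta)
  qed simp
qed

text \<open>The scalar function \<open>norm (f x - s i x)\<close> serves as majorant: its integral
  is eventually finite and small. The lemma is used both to find the Bochner integral and to show
  that every approximating sequence leads to the same value.\<close>

lemma bochner_limit_has_integral:
  fixes f :: "real \<Rightarrow> 'a::banach"
  assumes S: "S \<in> sets lebesgue" "S \<subseteq> {a..b}"
    and s: "\<And>i. Bochner_Integration.simple_bochner_integrable (lebesgue_on S) (s i)"
    and meas: "\<And>i. (\<lambda>x. norm (f x - s i x)) \<in> borel_measurable (lebesgue_on S)"
    and lim: "(\<lambda>i. \<integral>\<^sup>+x. ennreal (norm (f x - s i x)) \<partial>lebesgue_on S) \<longlonglongrightarrow> 0"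
  shows "f integrable_on S"
    and "(\<lambda>i. Bochner_Integration.simple_bochner_integral (lebesgue_on S) (s i)) \<longlonglongrightarrow> integral S f"
proof -
  have lm: "S \<in> lmeasurable"
    by (rule fmeasurableI2[of "{a..b}"]) (use S in auto)
  note hs = has_integral_simple_bochner[OF lm s]
  have small: "\<forall>\<^sub>F i in sequentially. (\<lambda>x. norm (f x - s i x)) integrable_on S \<and>
      integral S (\<lambda>x. norm (f x - s i x)) < e" if "e > 0" for e :: real
  proof -
    have "\<forall>\<^sub>F i in sequentially. (\<integral>\<^sup>+x. ennreal (norm (f x - s i x)) \<partial>lebesgue_on S) < ennreal e"
      by (rule order_tendstoD(2)[OF lim]) (use that in simp)
    then show ?thesis
    proof eventually_elim
      case (elim i)
      have int: "integrable (lebesgue_on S) (\<lambda>x. norm (f x - s i x))"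
      proof (rule integrableI_bounded[OF meas])
        show "(\<integral>\<^sup>+ x. ennreal (norm (norm (f x - s i x))) \<partial>lebesgue_on S) < \<infinity>"
          using order.strict_trans[OF elim ennreal_less_top] by simp
      qed
      have "ennreal (integral\<^sup>L (lebesgue_on S) (\<lambda>x. norm (f x - s i x))) < ennreal e"
        using elim nn_integral_eq_integral[OF int] by simp
      then have "integral\<^sup>L (lebesgue_on S) (\<lambda>x. norm (f x - s i x)) < e"
        by (simp add: ennreal_less_iff)
      with has_integral_integral_lebesgue_on[OF int S(1)] show ?case
        by (auto simp: integral_unique has_integral_integrable)
    qed
  qed
  show f: "f integrable_on S"
  proof (rule integrable_norm_approx)
    show "S \<subseteq> cbox a b" using S by simp
    fix e :: real assume "e > 0"
    then obtain i where "(\<lambda>x. norm (f x - s i x)) integrable_on S" "integral S (\<lambda>x. norm (f x - s i x)) < e"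
      using eventually_happens[OF small] by (auto simp: eventually_sequentially)
    then show "\<exists>g q. g integrable_on S \<and> q integrable_on S \<and>
            (\<forall>x\<in>S. norm (f x - g x) \<le> q x) \<and> integral S q < e"
      using hs[of i] by (intro exI[of _ "s i"] exI[of _ "\<lambda>x. norm (f x - s i x)"]) auto
  qed
  show "(\<lambda>i. Bochner_Integration.simple_bochner_integral (lebesgue_on S) (s i)) \<longlonglongrightarrow> integral S f"
    unfolding tendsto_iff
  proof (intro allI impI)
    fix e :: real assume "e > 0"
    from small[OF this] show "\<forall>\<^sub>F i in sequentially.
       dist (Bochner_Integration.simple_bochner_integral (lebesgue_on S) (s i)) (integral S f) < e"
    proof eventually_elim
      case (elim i)
      have "norm (integral S (\<lambda>x. f x - s i x)) \<le> integral S (\<lambda>x. norm (f x - s i x))"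
        using elim f hs[of i] by (intro Henstock_Kurzweil_Integration.integral_norm_bound_integral integrable_diff) auto
      moreover have "integral S (\<lambda>x. f x - s i x) = integral S f - Bochner_Integration.simple_bochner_integral (lebesgue_on S) (s i)"
        using f hs[of i] by (subst Henstock_Kurzweil_Integration.integral_diff) (auto simp: integral_unique)
      ultimately show ?case using elim by (simp add: dist_norm norm_minus_commute)
    qed
  qed
qed

text \<open>Simple functions built from \<open>k\<close> and from approximations of the identity
  converge to the integrand in mean, by dominated convergence. The Henstock-Kurzweil integral is
  then the only possible Bochner value.\<close>

lemma bochner_integral_eq_integral:
  fixes h :: "real \<Rightarrow> 'a::banach" and k :: "real \<Rightarrow> real"
  assumes S: "S \<in> sets lebesgue" "S \<subseteq> {a..b}"
    and k: "integrable (lebesgue_on S) k"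
    and h: "continuous_on {a..b} h"
  shows "(\<lambda>t. k t *\<^sub>R h t) integrable_on S"
    and "bochner_integral (lebesgue_on S) (\<lambda>t. k t *\<^sub>R h t) = integral S (\<lambda>t. k t *\<^sub>R h t)"
proof -
  let ?M = "lebesgue_on S"
  let ?f = "\<lambda>t. k t *\<^sub>R h t"
  \<comment> \<open>Clamping the argument extends \<open>h\<close> continuously to the whole line,
    so that it can be evaluated at simple approximations of \<open>x\<close> that leave
    \<open>{a..b}\<close>.\<close>
  define H where "H x = h (max a (min b x))" for x
  have ab: "a \<le> b" if "x \<in> S" for x using S that by force
  obtain C where C: "C > 0" "\<And>x. x \<in> {a..b} \<Longrightarrow> norm (h x) \<le> C"
  proof -
    have "bounded (h ` {a..b})"
      by (rule compact_imp_bounded[OF compact_continuous_image[OF h]]) simp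
    then show ?thesis using that by (auto simp: bounded_pos)
  qed
  have HC: "norm (H x) \<le> C" if "a \<le> b" for x
    unfolding H_def using that by (intro C) auto
  have [measurable]: "k \<in> borel_measurable ?M" using k by simp
  obtain K where K: "\<And>i. simple_function ?M (K i)" "\<And>x. x \<in> S \<Longrightarrow> (\<lambda>i. K i x) \<longlonglongrightarrow> k x"
     "\<And>i x. x \<in> S \<Longrightarrow> norm (K i x) \<le> 2 * norm (k x)"
    using borel_measurable_implies_sequence_metric[of k ?M 0] by (simp add: dist_norm) metis
  \<comment> \<open>The identity is a pointwise limit of simple functions \<open>c i\<close>.
    Composing with \<open>H\<close> gives simple functions with limit \<open>h\<close>, whatever the
    Banach space: this supplies the strong measurability.\<close>
  have "(\<lambda>x::real. x) \<in> borel_measurable ?M" 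
    by (rule continuous_imp_measurable_on_sets_lebesgue) (use S in auto)
  then obtain c where c: "\<And>i. simple_function ?M (c i)" "\<And>x. x \<in> S \<Longrightarrow> (\<lambda>i. c i x) \<longlonglongrightarrow> x"
    using borel_measurable_implies_sequence_metric[of "\<lambda>x::real. x" ?M 0] by (simp add: dist_norm) metis
  define s where "s i x = K i x *\<^sub>R H (c i x)" for i x
  have sf: "simple_function ?M (s i)" for i
    unfolding s_def using K(1) c(1) by (rule simple_function_compose2)
  have s_lim: "(\<lambda>i. s i x) \<longlonglongrightarrow> ?f x" if x: "x \<in> S" for x
  proof -
    have "continuous_on UNIV H"
      unfolding H_def using ab[OF x]
      by (intro continuous_on_compose2[OF h] continuous_intros) auto
    then have "(\<lambda>i. H (c i x)) \<longlonglongrightarrow> H x"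
      using c(2)[OF x] by (auto simp: continuous_on_eq_continuous_at intro: isCont_tendsto_compose)
    then have "(\<lambda>i. s i x) \<longlonglongrightarrow> k x *\<^sub>R H x"
      unfolding s_def using K(2)[OF x] by (intro tendsto_scaleR)
    moreover have "H x = h x" using x S by (auto simp: H_def min_absorb2 max_absorb2)
    ultimately show ?thesis by simp
  qed
  \<comment> \<open>Measurability is claimed for every simple \<open>t\<close>, not only for
    \<open>s i\<close>, because the uniqueness argument meets an arbitrary approximating
    sequence.\<close>
  have meas: "(\<lambda>x. norm (?f x - t x)) \<in> borel_measurable ?M"
    if "simple_function ?M t" for t :: "real \<Rightarrow> 'a"
  proof (rule borel_measurable_LIMSEQ_metric)
    show "(\<lambda>x. norm (s i x - t x)) \<in> borel_measurable ?M" for i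
      by (rule borel_measurable_simple_function) (rule simple_function_compose2[OF sf that])
    show "(\<lambda>i. norm (s i x - t x)) \<longlonglongrightarrow> norm (?f x - t x)" if "x \<in> space ?M" for x
      using that by (intro tendsto_intros s_lim) simp
  qed
  have kfin: "(\<integral>\<^sup>+x. ennreal (norm (k x)) \<partial>?M) < \<infinity>"
    using k by (simp add: integrable_iff_bounded)
  \<comment> \<open>The dominating function: \<open>norm (?f x)\<close> is at most
    \<open>C * norm (k x)\<close> and \<open>norm (s i x)\<close> at most twice that.\<close>
  have dom: "(\<integral>\<^sup>+x. ennreal (3 * C * norm (k x)) \<partial>?M) < \<infinity>"
  proof -
    have "(\<integral>\<^sup>+x. ennreal (3 * C * norm (k x)) \<partial>?M) = ennreal (3 * C) * (\<integral>\<^sup>+x. ennreal (norm (k x)) \<partial>?M)"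
      using C(1) by (subst nn_integral_cmult[symmetric]) (auto simp: ennreal_mult)
    then show ?thesis using kfin by (simp add: ennreal_mult_less_top)
  qed
  have s_bd: "norm (s i x) \<le> 2 * C * norm (k x)" if "x \<in> S" for i x
  proof -
    have "norm (s i x) \<le> (2 * norm (k x)) * C"
      unfolding s_def norm_scaleR
      using K(3)[OF that] HC[OF ab[OF that]] by (intro mult_mono) auto
    then show ?thesis by (simp add: algebra_simps)
  qed
  have sbi: "Bochner_Integration.simple_bochner_integrable ?M (s i)" for i
  proof (rule Bochner_Integration.simple_bochner_integrableI_bounded[OF sf])
    have "(\<integral>\<^sup>+x. norm (s i x) \<partial>?M) \<le> (\<integral>\<^sup>+x. ennreal (3 * C * norm (k x)) \<partial>?M)"
    proof (intro nn_integral_mono ennreal_leI)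
      fix x assume "x \<in> space ?M"
      then have "norm (s i x) \<le> 2 * C * norm (k x)" using s_bd by simp
      also have "\<dots> \<le> 3 * C * norm (k x)" using C(1) by (intro mult_right_mono) auto
      finally show "norm (s i x) \<le> 3 * C * norm (k x)" .
    qed
    then show "(\<integral>\<^sup>+x. norm (s i x) \<partial>?M) < \<infinity>" using dom by (rule le_less_trans)
  qed
  have "(\<lambda>i. \<integral>\<^sup>+x. ennreal (norm (?f x - s i x)) \<partial>?M) \<longlonglongrightarrow> (\<integral>\<^sup>+x. 0 \<partial>?M)"
  proof (rule nn_integral_dominated_convergence[where w="\<lambda>x. ennreal (3 * C * norm (k x))"])
    show "(\<lambda>x. ennreal (norm (?f x - s i x))) \<in> borel_measurable ?M" for i
      using meas[OF sf] by measurable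
    show "AE x in ?M. ennreal (norm (?f x - s i x)) \<le> ennreal (3 * C * norm (k x))" for i
    proof (intro AE_I2 ennreal_leI)
      fix x assume x: "x \<in> space ?M"
      have "norm (?f x - s i x) \<le> norm (?f x) + norm (s i x)" by (rule norm_triangle_ineq4)
      also have "norm (?f x) \<le> norm (k x) * C"
        unfolding norm_scaleR real_norm_def using x S by (intro mult_left_mono C) auto
      finally show "norm (?f x - s i x) \<le> 3 * C * norm (k x)"
        using s_bd[of x i] x by (simp add: algebra_simps)
    qed
    show "AE x in ?M. (\<lambda>i. ennreal (norm (?f x - s i x))) \<longlonglongrightarrow> 0"
    proof (rule AE_I2)
      fix x assume x: "x \<in> space ?M"
      have "(\<lambda>i. norm (?f x - s i x)) \<longlonglongrightarrow> norm (?f x - ?f x)"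
        using x by (intro tendsto_intros s_lim) simp
      then show "(\<lambda>i. ennreal (norm (?f x - s i x))) \<longlonglongrightarrow> 0"
        using tendsto_ennrealI by fastforce
    qed
  qed (use dom in auto)
  then have lim: "(\<lambda>i. \<integral>\<^sup>+x. ennreal (norm (?f x - s i x)) \<partial>?M) \<longlonglongrightarrow> 0" by simp
  note * = bochner_limit_has_integral[OF S sbi meas[OF sf] lim]
  show "?f integrable_on S" by (rule *(1))
  have hb: "has_bochner ?M ?f (integral S ?f)"
    unfolding has_bochner_def using sbi s_lim lim *(2) by (intro exI[of _ s]) auto
  have "y = integral S ?f" if y: "has_bochner ?M ?f y" for y
  proof -
    obtain t where t: "\<And>i. Bochner_Integration.simple_bochner_integrable ?M (t i)"
      "(\<lambda>i. \<integral>\<^sup>+y. ennreal (norm (?f y - t i y)) \<partial>?M) \<longlonglongrightarrow> 0"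
      "(\<lambda>i. Bochner_Integration.simple_bochner_integral ?M (t i)) \<longlonglongrightarrow> y"
      using y unfolding has_bochner_def by blast
    have "(\<lambda>i. Bochner_Integration.simple_bochner_integral ?M (t i)) \<longlonglongrightarrow> integral S ?f"
      using t(1) by (intro bochner_limit_has_integral(2)[OF S t(1) meas t(2)])
         (auto elim: Bochner_Integration.simple_bochner_integrable.cases)
    with t(3) show ?thesis by (rule LIMSEQ_unique)
  qed
  with hb have "(THE y. has_bochner ?M ?f y) = integral S ?f"
    by (rule the_equality)
  moreover have "bochner_integrable ?M ?f"
    unfolding bochner_integrable_def using hb by (rule exI)
  ultimately show "bochner_integral ?M ?f = integral S ?f"
    unfolding bochner_integral_def by simp
qed


section \<open>The Abel integral and its semigroup property\<close>

text \<open>A partition of unity subordinate to a finite cover by balls on which \<open>f\<close>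
  varies by less than \<open>e\<close>. The nonnegative coefficients allow Tonelli's theorem to be
  applied to each of them later.\<close>

lemma continuous_on_finite_rank_approx:
  fixes f :: "'m::metric_space \<Rightarrow> 'a::real_normed_vector"
  assumes S: "compact S" and f: "continuous_on S f" and e: "e > 0"
  obtains C \<phi> where "finite C" "\<And>c. c \<in> C \<Longrightarrow> continuous_on S (\<phi> c)"
    "\<And>c x. c \<in> C \<Longrightarrow> x \<in> S \<Longrightarrow> 0 \<le> (\<phi> c x :: real)"
    "\<And>x. x \<in> S \<Longrightarrow> norm (f x - (\<Sum>c\<in>C. \<phi> c x *\<^sub>R f c)) \<le> e"
proof -
  obtain d where d: "d > 0" "\<And>x y. x \<in> S \<Longrightarrow> y \<in> S \<Longrightarrow> dist y x < d \<Longrightarrow> dist (f y) (f x) < e"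
    using compact_uniformly_continuous[OF f S] e unfolding uniformly_continuous_on_def by blast
  obtain C where C: "C \<subseteq> S" "finite C" "S \<subseteq> (\<Union>c\<in>C. ball c d)"
    using compactE_image[OF S, of S "\<lambda>c. ball c d"] d(1) by (metis UN_I centre_in_ball open_ball subsetI)
  \<comment> \<open>A tent function supported on the ball of radius \<open>d\<close> about
    \<open>c\<close>. Normalising by the sum \<Phi>, positive on \<open>S\<close> because the balls
    cover it, gives the partition of unity.\<close>
  define \<psi> where "\<psi> c x = max 0 (d - dist c x)" for c x :: 'm
  define \<Phi> where "\<Phi> x = (\<Sum>c\<in>C. \<psi> c x)" for x
  have pos: "\<Phi> x > 0" if x: "x \<in> S" for x
  proof -
    obtain c where "c \<in> C" "x \<in> ball c d" using C(3) x by blast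
    then show ?thesis unfolding \<Phi>_def
      by (intro sum_pos2[of _ c]) (use C in \<open>auto simp: \<psi>_def\<close>)
  qed
  show ?thesis
  proof (rule that[of C "\<lambda>c x. \<psi> c x / \<Phi> x"])
    show "finite C" by fact
    show "continuous_on S (\<lambda>x. \<psi> c x / \<Phi> x)" for c
      unfolding \<psi>_def \<Phi>_def using pos unfolding \<psi>_def \<Phi>_def
      by (intro continuous_intros) force
    show "0 \<le> \<psi> c x / \<Phi> x" if "x \<in> S" for c x
      using pos[OF that] by (simp add: \<psi>_def)
    show "norm (f x - (\<Sum>c\<in>C. (\<psi> c x / \<Phi> x) *\<^sub>R f c)) \<le> e" if x: "x \<in> S" for x
    proof -
      have one: "(\<Sum>c\<in>C. \<psi> c x / \<Phi> x) = 1"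
        using pos[OF x] by (simp add: \<Phi>_def flip: sum_divide_distrib)
      have "f x - (\<Sum>c\<in>C. (\<psi> c x / \<Phi> x) *\<^sub>R f c) = (\<Sum>c\<in>C. (\<psi> c x / \<Phi> x) *\<^sub>R (f x - f c))"
        by (simp add: scaleR_diff_right sum_subtractf one flip: scaleR_left.sum)
      also have "norm \<dots> \<le> (\<Sum>c\<in>C. \<psi> c x / \<Phi> x * e)"
      proof (rule sum_norm_le)
        fix c assume c: "c \<in> C"
        show "norm ((\<psi> c x / \<Phi> x) *\<^sub>R (f x - f c)) \<le> \<psi> c x / \<Phi> x * e"
        proof (cases "dist c x < d")
          case True
          then have "norm (f x - f c) \<le> e"
            using d(2)[of x c] c C x by (metis dist_commute dist_norm less_imp_le subsetD)
          then show ?thesis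
            using pos[OF x] by (simp add: \<psi>_def divide_right_mono mult_left_mono)
        qed (simp add: \<psi>_def)
      qed
      also have "\<dots> = e" unfolding sum_distrib_right[symmetric] one by simp
      finally show ?thesis .
    qed
  qed
qed

section \<open>Integration against the power kernel\<close>

text \<open>For \<open>b > 0\<close> the antiderivative is continuous up to \<open>s = t\<close>
  even when the kernel is singular there, so the fundamental theorem with differentiability in the
  interior applies.\<close>

lemma has_integral_powr_kernel:
  fixes b c d t :: real
  assumes b: "0 < b" and "c \<le> d" "d \<le> t"
  shows "((\<lambda>s. (t - s) powr (b - 1)) has_integral ((t - c) powr b - (t - d) powr b) / b) {c..d}"
proof -
  have "((\<lambda>s. (t - s) powr (b - 1)) has_integral (- ((t - d) powr b / b) - (- ((t - c) powr b / b)))) {c..d}"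
  proof (rule fundamental_theorem_of_calculus_interior)
    show "continuous_on {c..d} (\<lambda>s. - ((t - s) powr b / b))"
      using assms by (intro continuous_intros continuous_on_powr') auto
    fix s assume "s \<in> {c<..<d}"
    then have "((\<lambda>s. - ((t - s) powr b / b)) has_real_derivative (t - s) powr (b - 1)) (at s)"
      using assms by (auto intro!: derivative_eq_intros simp: powr_diff field_simps)
    then show "((\<lambda>s. - ((t - s) powr b / b)) has_vector_derivative (t - s) powr (b - 1)) (at s)"
      by (simp add: has_real_derivative_iff_has_vector_derivative)
  qed fact
  then show ?thesis by (simp add: diff_divide_distrib)
qed

text \<open>The kernel is nonnegative, so its Henstock-Kurzweil integrability is Lebesgue
  integrability, as needed to pass to Bochner integrals.\<close>

lemma integrable_powr_kernel:
  fixes b c d t :: real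
  assumes "0 < b" "d \<le> t"
  shows "integrable (lebesgue_on {c..d}) (\<lambda>s. (t - s) powr (b - 1))"
proof (cases "c \<le> d")
  case True
  then show ?thesis
    using has_integral_powr_kernel[OF assms(1) True assms(2)]
    by (intro absolutely_integrable_imp_integrable nonnegative_absolutely_integrable_1) auto
next
  case False
  then have "{c..d} = {}" by simp
  then show ?thesis
    by (intro absolutely_integrable_imp_integrable) (auto simp: set_integrable_def)
qed

lemma integrable_on_powr_kernel_scaleR:
  fixes f :: "real \<Rightarrow> 'a::banach" and b c d t :: real
  assumes "0 < b" "d \<le> t" "continuous_on {c..d} f"
  shows "(\<lambda>s. (t - s) powr (b - 1) *\<^sub>R f s) integrable_on {c..d}"
  by (rule bochner_integral_eq_integral(1)[OF _ _ integrable_powr_kernel[OF assms(1,2)] assms(3)]) auto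

lemma norm_integral_powr_kernel_le:
  fixes f :: "real \<Rightarrow> 'a::banach" and b c d t :: real
  assumes b: "0 < b" and cd: "c \<le> d" "d \<le> t" and f: "continuous_on {c..d} f"
    and M: "\<And>s. s \<in> {c..d} \<Longrightarrow> norm (f s) \<le> M"
  shows "norm (integral {c..d} (\<lambda>s. (t - s) powr (b - 1) *\<^sub>R f s)) \<le> M * (((t - c) powr b - (t - d) powr b) / b)"
proof -
  note hi = has_integral_mult_right[OF has_integral_powr_kernel[OF b cd], of M]
  have "norm (integral {c..d} (\<lambda>s. (t - s) powr (b - 1) *\<^sub>R f s)) \<le> integral {c..d} (\<lambda>s. M * (t - s) powr (b - 1))"
  proof (rule Henstock_Kurzweil_Integration.integral_norm_bound_integral)
    show "(\<lambda>s. M * (t - s) powr (b - 1)) integrable_on {c..d}" using hi by blast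
    fix s assume "s \<in> {c..d}"
    then show "norm ((t - s) powr (b - 1) *\<^sub>R f s) \<le> M * (t - s) powr (b - 1)"
      using M[of s] by (simp add: mult.commute mult_right_mono)
  qed (intro integrable_on_powr_kernel_scaleR b cd f)
  also have "\<dots> = M * (((t - c) powr b - (t - d) powr b) / b)" using hi by (rule integral_unique)
  finally show ?thesis .
qed

text \<open>The unnormalised Riemann--Liouville integral \<open>\<Gamma>(b) J\<^sup>b f\<close>, as a Henstock--Kurzweil integral.
  The integrand is \<open>0\<close> at \<open>s = t\<close> even for \<open>b = 1\<close>, because \<open>0 powr 0 = 0\<close>.\<close>

definition Abel_integral :: "real \<Rightarrow> real \<Rightarrow> (real \<Rightarrow> 'a::banach) \<Rightarrow> real \<Rightarrow> 'a" where
  "Abel_integral c b f t = integral {c..t} (\<lambda>s. (t - s) powr (b - 1) *\<^sub>R f s)"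

lemma Abel_integral_at_left [simp]: "Abel_integral c b f c = 0"
  by (simp add: Abel_integral_def)

lemma norm_Abel_integral_le:
  fixes f :: "real \<Rightarrow> 'a::banach"
  assumes "0 < b" "c \<le> t" "continuous_on {c..t} f" "\<And>s. s \<in> {c..t} \<Longrightarrow> norm (f s) \<le> M"
  shows "norm (Abel_integral c b f t) \<le> M * ((t - c) powr b / b)"
  using norm_integral_powr_kernel_le[OF assms(1,2) order_refl assms(3,4)] assms(1)
  by (simp add: Abel_integral_def)

lemma Abel_integral_one: "Abel_integral c 1 f t = integral {c..t} f"
  unfolding Abel_integral_def
  by (rule integral_spike[of "{t}"]) auto

lemma Abel_integral_diff:
  fixes f g :: "real \<Rightarrow> 'a::banach"
  assumes "0 < b" "continuous_on {c..t} f" "continuous_on {c..t} g"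
  shows "Abel_integral c b (\<lambda>s. f s - g s) t = Abel_integral c b f t - Abel_integral c b g t"
  unfolding Abel_integral_def scaleR_diff_right
  by (intro Henstock_Kurzweil_Integration.integral_diff integrable_on_powr_kernel_scaleR assms) auto

lemma Abel_integral_sum_scaleR:
  fixes f :: "'i \<Rightarrow> real \<Rightarrow> real" and x :: "'i \<Rightarrow> 'a::banach"
  assumes "0 < b" "finite I" "\<And>i. i \<in> I \<Longrightarrow> continuous_on {c..t} (f i)"
  shows "Abel_integral c b (\<lambda>s. \<Sum>i\<in>I. f i s *\<^sub>R x i) t = (\<Sum>i\<in>I. Abel_integral c b (f i) t *\<^sub>R x i)"
proof -
  have "((\<lambda>s. \<Sum>i\<in>I. ((t - s) powr (b - 1) *\<^sub>R f i s) *\<^sub>R x i) has_integral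
      (\<Sum>i\<in>I. Abel_integral c b (f i) t *\<^sub>R x i)) {c..t}"
    unfolding Abel_integral_def
    by (intro has_integral_sum has_integral_scaleR_left integrable_integral
        integrable_on_powr_kernel_scaleR assms order_refl)
  then show ?thesis
    unfolding Abel_integral_def by (simp add: scaleR_sum_right integral_unique)
qed

lemma Abel_integral_scaleR:
  fixes f :: "real \<Rightarrow> 'a::banach"
  shows "Abel_integral c b (\<lambda>s. r *\<^sub>R f s) t = r *\<^sub>R Abel_integral c b f t"
proof -
  have "(\<lambda>s. (t - s) powr (b - 1) *\<^sub>R r *\<^sub>R f s) = (\<lambda>s. r *\<^sub>R (t - s) powr (b - 1) *\<^sub>R f s)"
    by (simp add: mult.commute)
  then show ?thesis unfolding Abel_integral_def by (simp only: integral_cmul)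
qed

lemma Abel_integral_cong:
  assumes "\<And>s. s \<in> {c..t} \<Longrightarrow> f s = g s"
  shows "Abel_integral c b f t = Abel_integral c b g t"
  unfolding Abel_integral_def using assms by (intro integral_cong) auto

section \<open>Hoelder continuity of the Abel integral\<close>

text \<open>The difference splits into the integral over \<open>{s..t}\<close> and the change of
  kernel over \<open>{c..s}\<close>. As \<open>b \<le> 1\<close>, the kernel decreases when
  \<open>s\<close> is replaced by \<open>t\<close>, so its change has constant sign and integrates
  exactly. Each part contributes at most \<open>M * (t - s) powr b / b\<close>.\<close>

lemma Abel_integral_Hoelder_less:
  fixes f :: "real \<Rightarrow> 'a::banach"
  assumes b: "0 < b" "b \<le> 1" and c: "c \<le> s" "s < t" and f: "continuous_on {c..t} f"
    and M: "\<And>r. r \<in> {c..t} \<Longrightarrow> norm (f r) \<le> M"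
  shows "norm (Abel_integral c b f t - Abel_integral c b f s) \<le> 2 * M / b * (t - s) powr b"
proof -
  let ?k = "\<lambda>t r. (t - r) powr (b - 1)"
  have M0: "0 \<le> M" using order_trans[OF norm_ge_zero M[of s]] c by simp
  have f1: "continuous_on {c..s} f" using f c by (elim continuous_on_subset) auto
  have f2: "continuous_on {s..t} f" using f c by (elim continuous_on_subset) auto
  have i1: "(\<lambda>r. ?k t r *\<^sub>R f r) integrable_on {c..s}" and i2: "(\<lambda>r. ?k s r *\<^sub>R f r) integrable_on {c..s}"
    using b c by (intro integrable_on_powr_kernel_scaleR f1; simp)+
  have "Abel_integral c b f t = integral {c..s} (\<lambda>r. ?k t r *\<^sub>R f r) + integral {s..t} (\<lambda>r. ?k t r *\<^sub>R f r)"
    unfolding Abel_integral_def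
    by (rule Henstock_Kurzweil_Integration.integral_combine[symmetric])
       (use b c f in \<open>auto intro!: integrable_on_powr_kernel_scaleR\<close>)
  then have split: "Abel_integral c b f t - Abel_integral c b f s =
      integral {c..s} (\<lambda>r. ?k t r *\<^sub>R f r - ?k s r *\<^sub>R f r) + integral {s..t} (\<lambda>r. ?k t r *\<^sub>R f r)"
    unfolding Abel_integral_def using i1 i2 by (simp add: Henstock_Kurzweil_Integration.integral_diff)
  have A: "norm (integral {s..t} (\<lambda>r. ?k t r *\<^sub>R f r)) \<le> M * ((t - s) powr b / b)"
    using norm_integral_powr_kernel_le[OF b(1) _ order_refl f2, of M] M c by simp
  \<comment> \<open>At \<open>r = s\<close> the kernel \<open>?k s r\<close> is \<open>0\<close> by
    the convention \<open>0 powr x = 0\<close>, so the monotonicity fails at this point. The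
    majorant is altered there, which leaves its integral unchanged.\<close>
  define q where "q r = (if r = s then M * ?k t s else M * (?k s r - ?k t r))" for r
  have "((\<lambda>r. M * (?k s r - ?k t r)) has_integral
      M * (((s - c) powr b - (s - s) powr b) / b - ((t - c) powr b - (t - s) powr b) / b)) {c..s}"
    using b c by (intro has_integral_mult_right has_integral_diff has_integral_powr_kernel) auto
  then have q: "(q has_integral M * (((s - c) powr b - (s - s) powr b) / b - ((t - c) powr b - (t - s) powr b) / b)) {c..s}"
    by (rule has_integral_spike_finite[of "{s}", rotated 2]) (auto simp: q_def)
  have "norm (integral {c..s} (\<lambda>r. ?k t r *\<^sub>R f r - ?k s r *\<^sub>R f r)) \<le> integral {c..s} q"
  proof (rule Henstock_Kurzweil_Integration.integral_norm_bound_integral)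
    show "(\<lambda>r. ?k t r *\<^sub>R f r - ?k s r *\<^sub>R f r) integrable_on {c..s}"
      using i1 i2 by (rule integrable_diff)
    show "q integrable_on {c..s}" using q by blast
    fix r assume r: "r \<in> {c..s}"
    have "norm (?k t r *\<^sub>R f r - ?k s r *\<^sub>R f r) = \<bar>?k t r - ?k s r\<bar> * norm (f r)"
      by (simp flip: scaleR_diff_left)
    also have "\<dots> \<le> \<bar>?k t r - ?k s r\<bar> * M" using r c by (intro mult_left_mono M) auto
    also have "\<dots> \<le> q r"
    proof (cases "r = s")
      case False
      then have "?k t r \<le> ?k s r" using r b c by (intro powr_mono2') auto
      then show ?thesis using False by (simp add: q_def algebra_simps)
    qed (simp add: q_def)
    finally show "norm (?k t r *\<^sub>R f r - ?k s r *\<^sub>R f r) \<le> q r" .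
  qed
  also have "integral {c..s} q \<le> M * ((t - s) powr b / b)"
  proof -
    have "(s - c) powr b \<le> (t - c) powr b" using b c by (intro powr_mono2) auto
    then have "((s - c) powr b - (s - s) powr b) / b - ((t - c) powr b - (t - s) powr b) / b \<le> (t - s) powr b / b"
      using b by (simp add: divide_simps)
    then show ?thesis unfolding integral_unique[OF q] using M0 by (rule mult_left_mono)
  qed
  finally have "norm (Abel_integral c b f t - Abel_integral c b f s) \<le> M * ((t - s) powr b / b) + M * ((t - s) powr b / b)"
    unfolding split by (intro norm_triangle_le add_mono A)
  then show ?thesis by simp
qed

lemma Abel_integral_Hoelder:
  fixes f :: "real \<Rightarrow> 'a::banach"
  assumes b: "0 < b" "b \<le> 1" and f: "continuous_on {c..d} f"
    and M: "\<And>r. r \<in> {c..d} \<Longrightarrow> norm (f r) \<le> M"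
    and st: "s \<in> {c..d}" "t \<in> {c..d}"
  shows "norm (Abel_integral c b f t - Abel_integral c b f s) \<le> 2 * M / b * \<bar>t - s\<bar> powr b"
proof -
  have *: "norm (Abel_integral c b f y - Abel_integral c b f x) \<le> 2 * M / b * \<bar>y - x\<bar> powr b"
    if "x < y" "x \<in> {c..d}" "y \<in> {c..d}" for x y
  proof -
    have "continuous_on {c..y} f" using f that by (elim continuous_on_subset) auto
    then show ?thesis using Abel_integral_Hoelder_less[OF b _ that(1), of c f M] M that by auto
  qed
  consider "s < t" | "t < s" | "s = t" by linarith
  then show ?thesis
    by cases (use *[of s t] *[of t s] st in \<open>auto simp: norm_minus_commute abs_minus_commute\<close>)
qed

lemma Abel_integral_bounded_Hoelder:
  fixes f :: "real \<Rightarrow> 'a::banach"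
  assumes b: "0 < b" "b \<le> 1" and f: "continuous_on {c..d} f"
  obtains C where "C > 0" "\<And>s t. s \<in> {c..d} \<Longrightarrow> t \<in> {c..d} \<Longrightarrow>
      norm (Abel_integral c b f t - Abel_integral c b f s) \<le> C * \<bar>t - s\<bar> powr b"
proof -
  have "bounded (f ` {c..d})"
    by (rule compact_imp_bounded[OF compact_continuous_image[OF f]]) simp
  then obtain M where M: "M > 0" "\<And>x. x \<in> {c..d} \<Longrightarrow> norm (f x) \<le> M"
    by (auto simp: bounded_pos)
  show ?thesis
    by (rule that[of "2 * M / b"]) (use M b Abel_integral_Hoelder[OF b f M(2)] in auto)
qed

lemma continuous_on_Abel_integral:
  fixes f :: "real \<Rightarrow> 'a::banach"
  assumes b: "0 < b" "b \<le> 1" and f: "continuous_on {c..d} f"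
  shows "continuous_on {c..d} (Abel_integral c b f)"
proof -
  obtain C where C: "C > 0" "\<And>s t. s \<in> {c..d} \<Longrightarrow> t \<in> {c..d} \<Longrightarrow>
      norm (Abel_integral c b f t - Abel_integral c b f s) \<le> C * \<bar>t - s\<bar> powr b"
    using Abel_integral_bounded_Hoelder[OF assms] by blast
  show ?thesis
    unfolding continuous_on
  proof
    fix x assume x: "x \<in> {c..d}"
    have "((\<lambda>y. C * \<bar>y - x\<bar> powr b) \<longlongrightarrow> C * \<bar>x - x\<bar> powr b) (at x within {c..d})"
      using b by (intro tendsto_intros tendsto_powr') auto
    then have "((\<lambda>y. C * \<bar>y - x\<bar> powr b) \<longlongrightarrow> 0) (at x within {c..d})"
      using b by simp
    then have "((\<lambda>y. Abel_integral c b f y - Abel_integral c b f x) \<longlongrightarrow> 0) (at x within {c..d})"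
      by (rule Lim_null_comparison[rotated])
         (use C(2) x in \<open>auto simp: eventually_at intro!: exI[of _ 1]\<close>)
    then show "(Abel_integral c b f \<longlongrightarrow> Abel_integral c b f x) (at x within {c..d})"
      by (simp add: LIM_zero_iff)
  qed
qed

section \<open>The Beta integral and the semigroup property\<close>

text \<open>The substitution \<open>s = r + (t - r) * x\<close> carries the Beta integral over
  \<open>[0, 1]\<close> to \<open>{r..t}\<close>. For \<open>r = t\<close> both sides are
  \<open>0\<close>, again by \<open>0 powr x = 0\<close>.\<close>

lemma has_integral_Beta_interval:
  fixes a b r t :: real
  assumes "0 < a" "0 < b" "r \<le> t"
  shows "((\<lambda>s. (t - s) powr (a - 1) * (s - r) powr (b - 1)) has_integral
           Beta a b * (t - r) powr (a + b - 1)) {r..t}"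
proof (cases "r = t")
  case False
  define m where "m = t - r"
  have m: "m > 0" using assms False by (simp add: m_def)
  have "((\<lambda>x. x powr (b - 1) * (1 - x) powr (a - 1)) has_integral Beta b a) (cbox 0 1)"
    using has_integral_Beta_real[OF assms(2,1)] by simp
  moreover have "(0 - - r / m) /\<^sub>R (1 / m) = r" "(1 - - r / m) /\<^sub>R (1 / m) = m + r"
    using m by (simp_all add: field_simps)
  ultimately have "((\<lambda>s. (s / m - r / m) powr (b - 1) * (1 - (s / m - r / m)) powr (a - 1)) has_integral Beta b a * m) {r..m + r}"
    using has_integral_affinity'[of "\<lambda>x. x powr (b - 1) * (1 - x) powr (a - 1)" "Beta b a" 0 1 "1 / m" "- r / m"] m
    by (simp add: mult.commute)
  \<comment> \<open>The factor \<open>m powr (a + b - 2)\<close> undoes the scaling of the two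
    powers; the other factor \<open>m\<close> is the Jacobian.\<close>
  then have H: "((\<lambda>s. m powr (a + b - 2) * ((s / m - r / m) powr (b - 1) * (1 - (s / m - r / m)) powr (a - 1)))
      has_integral m powr (a + b - 2) * (Beta b a * m)) {r..t}"
    unfolding m_def by (intro has_integral_mult_right) simp
  have eqf: "m powr (a + b - 2) * ((s / m - r / m) powr (b - 1) * (1 - (s / m - r / m)) powr (a - 1)) =
         (t - s) powr (a - 1) * (s - r) powr (b - 1)" if s: "s \<in> {r..t}" for s
  proof -
    have "1 - (s / m - r / m) = (m + r - s) / m" using m by (simp add: field_simps)
    then have 1: "s / m - r / m = (s - r) / m" "1 - (s / m - r / m) = (t - s) / m"
      by (simp_all add: m_def diff_divide_distrib)
    have "m powr (a + b - 2) = m powr (a - 1) * m powr (b - 1)"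
      by (simp flip: powr_add)
    then show ?thesis
      unfolding 1(2) unfolding 1(1) using m s by (simp add: powr_divide)
  qed
  have val: "m powr (a + b - 2) * (Beta b a * m) = Beta a b * (t - r) powr (a + b - 1)"
    using m powr_add[of m "a + b - 2" 1] by (simp add: Beta_commute[of b a] flip: m_def)
  from has_integral_eq[OF eqf H] show ?thesis unfolding val .
next
  case True
  then show ?thesis using has_integral_refl(2)[of _ t] by simp
qed

text \<open>Tonelli on the triangle \<open>c \<le> r \<le> s \<le> t\<close>: after exchanging the
  order, the inner integral over \<open>s\<close> is a Beta integral. Nonnegativity lets the whole
  computation run in extended nonnegative reals.\<close>

lemma Abel_integral_Abel_integral_nonneg:
  fixes \<phi> :: "real \<Rightarrow> real"
  assumes a: "0 < a" and b: "0 < b" "b \<le> 1" and t: "c \<le> t"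
    and \<phi>: "continuous_on {c..t} \<phi>" "\<And>s. s \<in> {c..t} \<Longrightarrow> 0 \<le> \<phi> s"
  shows "Abel_integral c a (Abel_integral c b \<phi>) t = Beta a b * Abel_integral c (a + b) \<phi> t"
proof -
  \<comment> \<open>Constant continuation beyond the end points makes the function Borel on the
    whole line, for joint measurability.\<close>
  define \<Phi> where "\<Phi> r = \<phi> (max c (min t r))" for r
  have cont: "continuous_on UNIV \<Phi>"
    unfolding \<Phi>_def using t by (intro continuous_on_compose2[OF \<phi>(1)] continuous_intros) auto
  then have [measurable]: "\<Phi> \<in> borel_measurable borel" by (rule borel_measurable_continuous_onI)
  have \<Phi>0: "0 \<le> \<Phi> r" for r unfolding \<Phi>_def using t by (intro \<phi>) auto
  have \<Phi>c: "continuous_on {c..s} \<Phi>" for s using cont continuous_on_subset by blast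
  have A: "Abel_integral c \<beta> \<phi> s = Abel_integral c \<beta> \<Phi> s" if "s \<le> t" for s \<beta>
    using that by (intro Abel_integral_cong) (auto simp: \<Phi>_def)
  have hi: "((\<lambda>r. (s - r) powr (\<beta> - 1) * \<Phi> r) has_integral Abel_integral c \<beta> \<Phi> s) {c..s}" if "0 < \<beta>" for \<beta> s
    using integrable_integral[OF integrable_on_powr_kernel_scaleR[OF that order_refl \<Phi>c[of s]]]
    by (simp add: Abel_integral_def)
  have nonneg: "0 \<le> Abel_integral c \<beta> \<Phi> s" if "0 < \<beta>" for \<beta> s
    by (rule has_integral_nonneg[OF hi[OF that]]) (simp add: \<Phi>0)
  have hi2: "((\<lambda>s. (t - s) powr (a - 1) * Abel_integral c b \<Phi> s) has_integral Abel_integral c a (Abel_integral c b \<Phi>) t) {c..t}"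
    using integrable_integral[OF integrable_on_powr_kernel_scaleR[OF a order_refl continuous_on_Abel_integral[OF b \<Phi>c[of t]]]]
    by (simp add: Abel_integral_def)
  \<comment> \<open>The two indicators cut out the triangle; they equal the product of the
    indicators of \<open>{c..t}\<close> at \<open>r\<close> and of \<open>{r..t}\<close> at
    \<open>s\<close>.\<close>
  let ?F = "\<lambda>s r. ennreal ((t - s) powr (a - 1) * (s - r) powr (b - 1) * \<Phi> r) *
     (indicator {c..t} s * indicator {c..s} r)"
  have [measurable]: "(\<lambda>(s, r). ?F s r) \<in> borel_measurable (lborel \<Otimes>\<^sub>M lborel)"
    unfolding indicator_def atLeastAtMost_iff by measurable
  have "ennreal (Abel_integral c a (Abel_integral c b \<Phi>) t) =
      (\<integral>\<^sup>+s. ennreal ((t - s) powr (a - 1) * Abel_integral c b \<Phi> s) * indicator {c..t} s \<partial>lborel)"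
    using nn_integral_has_integral_lebesgue'[OF _ hi2] nonneg b by simp
  also have "\<dots> = (\<integral>\<^sup>+s. (\<integral>\<^sup>+r. ?F s r \<partial>lborel) \<partial>lborel)"
  proof (intro nn_integral_cong)
    fix s :: real
    have "(\<integral>\<^sup>+r. ?F s r \<partial>lborel) = (\<integral>\<^sup>+r. ennreal ((t - s) powr (a - 1)) * indicator {c..t} s *
        (ennreal ((s - r) powr (b - 1) * \<Phi> r) * indicator {c..s} r) \<partial>lborel)"
      by (intro nn_integral_cong) (auto simp: \<Phi>0 ennreal_mult[symmetric] mult_ac split: split_indicator)
    also have "\<dots> = ennreal ((t - s) powr (a - 1)) * indicator {c..t} s *
        (\<integral>\<^sup>+r. ennreal ((s - r) powr (b - 1) * \<Phi> r) * indicator {c..s} r \<partial>lborel)"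
      by (rule nn_integral_cmult) measurable
    also have "\<dots> = ennreal ((t - s) powr (a - 1) * Abel_integral c b \<Phi> s) * indicator {c..t} s"
      using nn_integral_has_integral_lebesgue'[OF _ hi[OF b(1)], of s] \<Phi>0 nonneg b
      by (simp add: ennreal_mult mult_ac)
    finally show "ennreal ((t - s) powr (a - 1) * Abel_integral c b \<Phi> s) * indicator {c..t} s =
        (\<integral>\<^sup>+r. ?F s r \<partial>lborel)" ..
  qed
  also have "\<dots> = (\<integral>\<^sup>+r. (\<integral>\<^sup>+s. ?F s r \<partial>lborel) \<partial>lborel)"
    by (rule lborel_pair.Fubini'[symmetric]) measurable
  also have "\<dots> = (\<integral>\<^sup>+r. ennreal (Beta a b * ((t - r) powr (a + b - 1) * \<Phi> r)) * indicator {c..t} r \<partial>lborel)"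
  proof (intro nn_integral_cong)
    fix r :: real
    have "(\<integral>\<^sup>+s. ?F s r \<partial>lborel) = (\<integral>\<^sup>+s. ennreal (\<Phi> r) * indicator {c..t} r *
        (ennreal ((t - s) powr (a - 1) * (s - r) powr (b - 1)) * indicator {r..t} s) \<partial>lborel)"
      by (intro nn_integral_cong) (auto simp: \<Phi>0 ennreal_mult[symmetric] mult_ac split: split_indicator)
    also have "\<dots> = ennreal (\<Phi> r) * indicator {c..t} r *
        (\<integral>\<^sup>+s. ennreal ((t - s) powr (a - 1) * (s - r) powr (b - 1)) * indicator {r..t} s \<partial>lborel)"
      by (rule nn_integral_cmult) measurable
    also have "\<dots> = ennreal (Beta a b * ((t - r) powr (a + b - 1) * \<Phi> r)) * indicator {c..t} r"
    proof (cases "r \<le> t")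
      case True
      have "0 \<le> Beta a b * (t - r) powr (a + b - 1)"
        by (rule has_integral_nonneg[OF has_integral_Beta_interval[OF a b(1) True]]) simp
      then show ?thesis
        using nn_integral_has_integral_lebesgue'[OF _ has_integral_Beta_interval[OF a b(1) True]] \<Phi>0[of r]
        by (simp add: ennreal_mult[symmetric] mult_ac split: split_indicator)
    qed simp
    finally show "(\<integral>\<^sup>+s. ?F s r \<partial>lborel) = ennreal (Beta a b * ((t - r) powr (a + b - 1) * \<Phi> r)) * indicator {c..t} r" .
  qed
  also have "\<dots> = ennreal (Beta a b * Abel_integral c (a + b) \<Phi> t)"
  proof (rule nn_integral_has_integral_lebesgue')
    show "((\<lambda>r. Beta a b * ((t - r) powr (a + b - 1) * \<Phi> r)) has_integral Beta a b * Abel_integral c (a + b) \<Phi> t) {c..t}"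
      using a b by (intro has_integral_mult_right hi) simp
    show "0 \<le> Beta a b * ((t - r) powr (a + b - 1) * \<Phi> r)" for r
      using a b \<Phi>0 by (simp add: Beta_def Gamma_real_pos less_imp_le)
  qed
  finally have "Abel_integral c a (Abel_integral c b \<Phi>) t = Beta a b * Abel_integral c (a + b) \<Phi> t"
  proof (subst (asm) ennreal_inj)
    show "0 \<le> Abel_integral c a (Abel_integral c b \<Phi>) t"
      by (rule has_integral_nonneg[OF hi2]) (simp add: nonneg b)
    show "0 \<le> Beta a b * Abel_integral c (a + b) \<Phi> t"
      using a b nonneg[of "a + b" t] by (simp add: Beta_def Gamma_real_pos less_imp_le)
  qed
  moreover have "Abel_integral c a (Abel_integral c b \<phi>) t = Abel_integral c a (Abel_integral c b \<Phi>) t"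
    by (intro Abel_integral_cong A) simp
  ultimately show ?thesis using A[of t] by simp
qed

proposition Abel_integral_Abel_integral:
  fixes f :: "real \<Rightarrow> 'a::banach"
  assumes a: "0 < a" and b: "0 < b" "b \<le> 1" and t: "c \<le> t"
    and f: "continuous_on {c..t} f"
  shows "Abel_integral c a (Abel_integral c b f) t = Beta a b *\<^sub>R Abel_integral c (a + b) f t"
proof -
  \<comment> \<open>A Fubini theorem for singular Banach-valued integrands is avoided: both sides are bounded
    operators in \<open>f\<close>, so finite sums of nonnegative scalar functions times vectors suffice.\<close>
  define D where "D g = Abel_integral c a (Abel_integral c b g) t - Beta a b *\<^sub>R Abel_integral c (a + b) g t"
    for g :: "real \<Rightarrow> 'a"
  \<comment> \<open>A bound for the operator \<open>D\<close> in the supremum norm: one summand for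
    the iterated integral, one for the integral of order \<open>a + b\<close>.\<close>
  define C where "C = (t - c) powr b / b * ((t - c) powr a / a) + \<bar>Beta a b\<bar> * ((t - c) powr (a + b) / (a + b))"
  have ab: "0 < a + b" using a b by simp
  have sub: "continuous_on {c..s} g" if "continuous_on {c..t} g" "s \<le> t" for s and g :: "real \<Rightarrow> 'x::banach"
    using that by (elim continuous_on_subset) auto
  have bound: "norm (D g) \<le> e * C" if g: "continuous_on {c..t} g" and e: "\<And>s. s \<in> {c..t} \<Longrightarrow> norm (g s) \<le> e" for g e
  proof -
    have e0: "0 \<le> e" using order_trans[OF norm_ge_zero e[of c]] t by simp
    have "norm (Abel_integral c b g s) \<le> e * ((t - c) powr b / b)" if s: "s \<in> {c..t}" for s
    proof -
      have "norm (Abel_integral c b g s) \<le> e * ((s - c) powr b / b)"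
        using s e by (intro norm_Abel_integral_le b sub[OF g]) auto
      also have "\<dots> \<le> e * ((t - c) powr b / b)"
        using s b e0 by (intro mult_left_mono divide_right_mono powr_mono2) auto
      finally show ?thesis .
    qed
    then have "norm (Abel_integral c a (Abel_integral c b g) t) \<le> e * ((t - c) powr b / b) * ((t - c) powr a / a)"
      by (intro norm_Abel_integral_le a t continuous_on_Abel_integral b g)
    moreover have "norm (Abel_integral c (a + b) g t) \<le> e * ((t - c) powr (a + b) / (a + b))"
      using e by (intro norm_Abel_integral_le ab t g)
    then have "norm (Beta a b *\<^sub>R Abel_integral c (a + b) g t) \<le> \<bar>Beta a b\<bar> * (e * ((t - c) powr (a + b) / (a + b)))"
      unfolding norm_scaleR by (intro mult_left_mono) auto
    ultimately have "norm (D g) \<le> e * ((t - c) powr b / b) * ((t - c) powr a / a) +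
       \<bar>Beta a b\<bar> * (e * ((t - c) powr (a + b) / (a + b)))"
      unfolding D_def by (meson add_mono norm_triangle_ineq4 order_trans)
    then show ?thesis by (simp add: C_def algebra_simps)
  qed
  have diff: "D (\<lambda>s. g s - h s) = D g - D h" if g: "continuous_on {c..t} g" and h: "continuous_on {c..t} h" for g h
  proof -
    have "Abel_integral c a (Abel_integral c b (\<lambda>s. g s - h s)) t
        = Abel_integral c a (\<lambda>s. Abel_integral c b g s - Abel_integral c b h s) t"
      by (intro Abel_integral_cong Abel_integral_diff b sub[OF g] sub[OF h]) auto
    also have "\<dots> = Abel_integral c a (Abel_integral c b g) t - Abel_integral c a (Abel_integral c b h) t"
      by (intro Abel_integral_diff a continuous_on_Abel_integral b g h)
    finally show ?thesis
      unfolding D_def Abel_integral_diff[OF ab g h] scaleR_diff_right by simp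
  qed
  \<comment> \<open>The index set consists of reals because the approximation below is indexed by
    centres in the interval.\<close>
  have rank: "D (\<lambda>s. \<Sum>i\<in>I. \<phi> i s *\<^sub>R x i) = 0"
    if I: "finite I" and \<phi>: "\<And>i. i \<in> I \<Longrightarrow> continuous_on {c..t} (\<phi> i)" "\<And>i s. i \<in> I \<Longrightarrow> s \<in> {c..t} \<Longrightarrow> 0 \<le> \<phi> i s"
    for I :: "real set" and \<phi> :: "real \<Rightarrow> real \<Rightarrow> real" and x
  proof -
    have "Abel_integral c a (Abel_integral c b (\<lambda>s. \<Sum>i\<in>I. \<phi> i s *\<^sub>R x i)) t
        = Abel_integral c a (\<lambda>s. \<Sum>i\<in>I. Abel_integral c b (\<phi> i) s *\<^sub>R x i) t"
      using \<phi> by (intro Abel_integral_cong Abel_integral_sum_scaleR b I sub[OF \<phi>(1)]) auto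
    also have "\<dots> = (\<Sum>i\<in>I. Abel_integral c a (Abel_integral c b (\<phi> i)) t *\<^sub>R x i)"
      by (intro Abel_integral_sum_scaleR a I continuous_on_Abel_integral b \<phi>)
    also have "\<dots> = (\<Sum>i\<in>I. (Beta a b * Abel_integral c (a + b) (\<phi> i) t) *\<^sub>R x i)"
      by (intro sum.cong arg_cong2[where f=scaleR] Abel_integral_Abel_integral_nonneg[OF a b t] \<phi> refl)
    also have "\<dots> = Beta a b *\<^sub>R Abel_integral c (a + b) (\<lambda>s. \<Sum>i\<in>I. \<phi> i s *\<^sub>R x i) t"
      by (simp add: Abel_integral_sum_scaleR[OF ab I \<phi>(1)] scaleR_sum_right)
    finally show ?thesis by (simp add: D_def)
  qed
  have "norm (D f) \<le> 0 + e" if "e > 0" for e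
  proof -
    have C0: "0 \<le> C" unfolding C_def using a b by simp
    \<comment> \<open>The denominator \<open>C + 1\<close> is positive even if \<open>C = 0\<close>,
      and gives \<open>\<delta> * C \<le> e\<close>.\<close>
    define \<delta> where "\<delta> = e / (C + 1)"
    have \<delta>: "\<delta> > 0" using \<open>e > 0\<close> C0 by (simp add: \<delta>_def)
    obtain I \<phi> where I: "finite I" "\<And>i. i \<in> I \<Longrightarrow> continuous_on {c..t} (\<phi> i)"
      "\<And>i x. i \<in> I \<Longrightarrow> x \<in> {c..t} \<Longrightarrow> 0 \<le> (\<phi> i x :: real)"
      "\<And>x. x \<in> {c..t} \<Longrightarrow> norm (f x - (\<Sum>i\<in>I. \<phi> i x *\<^sub>R f i)) \<le> \<delta>"
      using continuous_on_finite_rank_approx[OF compact_Icc f \<delta>] by metis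
    have p: "continuous_on {c..t} (\<lambda>s. \<Sum>i\<in>I. \<phi> i s *\<^sub>R f i)"
      by (intro continuous_intros I)
    have "norm (D f) = norm (D (\<lambda>s. f s - (\<Sum>i\<in>I. \<phi> i s *\<^sub>R f i)))"
      using diff[OF f p] rank[OF I(1-3)] by simp
    also have "\<dots> \<le> \<delta> * C"
      by (rule bound[OF _ I(4)]) (intro continuous_intros f p)
    also have "\<dots> \<le> e" using C0 \<open>e > 0\<close> by (simp add: \<delta>_def field_simps)
    finally show ?thesis by simp
  qed
  then have "norm (D f) \<le> 0" by (rule field_le_epsilon)
  then show ?thesis by (simp add: D_def)
qed

text \<open>Both sides are multiples of the Abel integral of order \<open>a + b\<close>, with equal
  factors by symmetry of the Beta function.\<close>

corollary Abel_integral_commute: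
  fixes f :: "real \<Rightarrow> 'a::banach"
  assumes "0 < a" "a \<le> 1" "0 < b" "b \<le> 1" "c \<le> t" "continuous_on {c..t} f"
  shows "Abel_integral c a (Abel_integral c b f) t = Abel_integral c b (Abel_integral c a f) t"
  using assms by (simp add: Abel_integral_Abel_integral Beta_commute[of b a] add.commute)


section \<open>Test functions and the lemma of du Bois-Reymond\<close>

text \<open>Every derivative of \<open>exp (- 1 / x)\<close>, extended by \<open>0\<close> to \<open>x \<le> 0\<close>, has this form.\<close>

definition poly_exp :: "real poly \<Rightarrow> real \<Rightarrow> real" where
  "poly_exp p x = (if x > 0 then poly p (1 / x) * exp (- (1 / x)) else 0)"

lemma poly_exp_minus: "poly_exp (- p) x = - poly_exp p x"
  by (simp add: poly_exp_def)

lemma tendsto_poly_div_exp_0: "((\<lambda>y. poly p y * exp (- y)) \<longlongrightarrow> (0::real)) at_top"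
proof -
  have "((\<lambda>y. \<Sum>i\<le>degree p. coeff p i * (y ^ i / exp y)) \<longlongrightarrow> (\<Sum>i\<le>degree p. coeff p i * 0)) at_top"
    by (intro tendsto_intros tendsto_power_div_exp_0)
  then show ?thesis
    by (simp add: poly_altdef sum_distrib_right exp_minus divide_inverse mult.assoc)
qed

text \<open>With \<open>y = 1 / x\<close>, the derivative of \<open>p(y) * exp (- y)\<close> is
  \<open>y^2 * (p(y) - p'(y)) * exp (- y)\<close>. At \<open>0\<close> the right difference quotient
  tends to \<open>0\<close> because the exponential beats every polynomial.\<close>

lemma has_real_derivative_poly_exp:
  "(poly_exp p has_real_derivative poly_exp ([:0, 0, 1:] * (p - pderiv p)) x) (at x)"
proof -
  consider "x > 0" | "x < 0" | "x = 0" by linarith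
  then show ?thesis
  proof cases
    case 1
    have "((\<lambda>x. poly p (1 / x) * exp (- (1 / x))) has_real_derivative poly_exp ([:0, 0, 1:] * (p - pderiv p)) x) (at x)"
      using 1 by (auto intro!: derivative_eq_intros DERIV_chain2[OF poly_DERIV] simp: poly_exp_def field_simps power2_eq_square)
    then show ?thesis
      by (rule has_field_derivative_transform_within_open[of _ _ _ "{0<..}"]) (use 1 in \<open>auto simp: poly_exp_def\<close>)
  next
    case 2
    have "((\<lambda>x. 0) has_real_derivative poly_exp ([:0, 0, 1:] * (p - pderiv p)) x) (at x)"
      using 2 by (simp add: poly_exp_def)
    then show ?thesis
      by (rule has_field_derivative_transform_within_open[of _ _ _ "{..<0}"]) (use 2 in \<open>auto simp: poly_exp_def\<close>)
  next
    case 3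
    have "((\<lambda>h. poly_exp p h / h) \<longlongrightarrow> 0) (at_right 0)"
    proof -
      \<comment> \<open>Division by \<open>h\<close> multiplies the polynomial in
        \<open>1 / h\<close> by its variable.\<close>
      have "((\<lambda>h. poly (pCons 0 p) (inverse h) * exp (- inverse h)) \<longlongrightarrow> 0) (at_right (0::real))"
        by (rule filterlim_compose[OF tendsto_poly_div_exp_0 filterlim_inverse_at_top_right])
      then show ?thesis
        by (rule Lim_transform_eventually)
           (auto simp: eventually_at_right_field poly_exp_def field_simps intro!: exI[of _ 1])
    qed
    moreover have "((\<lambda>h. poly_exp p h / h) \<longlongrightarrow> 0) (at_left 0)"
      by (rule tendsto_eventually) (auto simp: eventually_at_left_field poly_exp_def intro!: exI[of _ "-1"])
    ultimately have "((\<lambda>h. poly_exp p h / h) \<longlongrightarrow> 0) (at 0)"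
      by (rule filterlim_split_at[rotated])
    then show ?thesis
      using 3 by (simp add: DERIV_def poly_exp_def)
  qed
qed

section \<open>Smooth bumps and test functions\<close>

text \<open>Each summand vanishes outside the open interval from \<open>u\<close> to
  \<open>w\<close>. Sums are taken over lists so that the product rule stays within the
  class.\<close>

definition bump_sum :: "(real \<times> real \<times> real poly \<times> real poly) list \<Rightarrow> real \<Rightarrow> real" where
  "bump_sum L s = (\<Sum>(u, w, p, q)\<leftarrow>L. poly_exp p (s - u) * poly_exp q (w - s))"

lemma has_real_derivative_bump_sum:
  "\<exists>L'. \<forall>s. (bump_sum L has_real_derivative bump_sum L' s) (at s)"
proof (induction L)
  case Nil
  show ?case by (rule exI[of _ "[]"]) (simp add: bump_sum_def)
next
  case (Cons z L)
  obtain u w p q where z: "z = (u, w, p, q)" by (cases z)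
  obtain L' where L': "\<And>s. (bump_sum L has_real_derivative bump_sum L' s) (at s)" using Cons by blast
  let ?D = "\<lambda>p. [:0, 0, 1:] * (p - pderiv p)"
  show ?case
  proof (intro exI allI)
    fix s
    have "((\<lambda>s. poly_exp p (s - u) * poly_exp q (w - s)) has_real_derivative
       (poly_exp (?D p) (s - u) * poly_exp q (w - s) + poly_exp p (s - u) * poly_exp (- ?D q) (w - s))) (at s)"
      unfolding poly_exp_minus
      by (auto intro!: derivative_eq_intros DERIV_chain2[OF has_real_derivative_poly_exp])
    from DERIV_add[OF this L']
    show "(bump_sum (z # L) has_real_derivative bump_sum ((u, w, ?D p, q) # (u, w, p, - ?D q) # L') s) (at s)"
      unfolding bump_sum_def z by (simp add: add.assoc)
  qed
qed

text \<open>Closure of \<open>S\<close> under differentiation yields derivatives of all orders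
  without computing any of them.\<close>

lemma higher_deriv_closed:
  assumes S: "\<And>f. f \<in> S \<Longrightarrow> \<exists>g\<in>S. \<forall>x. (f has_real_derivative g x) (at x)" and f: "f \<in> S"
  shows "(deriv ^^ k) f \<in> S"
proof (induction k)
  case (Suc k)
  then obtain g where "g \<in> S" "\<And>x. ((deriv ^^ k) f has_real_derivative g x) (at x)"
    using S by blast
  moreover from this have "deriv ((deriv ^^ k) f) = g"
    by (auto intro!: ext DERIV_imp_deriv)
  ultimately show ?case by simp
qed (use f in simp)

lemma test_functionI:
  assumes \<phi>: "\<And>x. (\<phi> has_real_derivative bump_sum L x) (at x)"
    and zero: "\<And>x. x \<notin> {l..r} \<Longrightarrow> \<phi> x = 0" and lr: "a < l" "r < b"
  shows "test_function a b \<phi>"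
proof -
  \<comment> \<open>\<phi> is adjoined separately: only its derivative is known to be a bump
    sum.\<close>
  define S where "S = insert \<phi> (range bump_sum)"
  have S: "\<exists>g\<in>S. \<forall>x. (f has_real_derivative g x) (at x)" if "f \<in> S" for f
    using that \<phi> has_real_derivative_bump_sum unfolding S_def by blast
  have "((deriv ^^ k) \<phi>) differentiable (at x)" for k x
    using S[OF higher_deriv_closed[OF S, of \<phi> k]] real_differentiable_def unfolding S_def by blast
  moreover have sub: "closure {x. \<phi> x \<noteq> 0} \<subseteq> {l..r}"
  proof (rule closure_minimal)
    show "{x. \<phi> x \<noteq> 0} \<subseteq> {l..r}" using zero by blast
  qed simp
  then have "compact (closure {x. \<phi> x \<noteq> 0})"
    using compact_Int_closed[OF compact_Icc[of l r] closed_closure[of "{x. \<phi> x \<noteq> 0}"]] by (simp add: Int_absorb1)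
  ultimately show ?thesis
    using lr unfolding test_function_def by (auto dest!: subsetD[OF sub])
qed

lemma antiderivative_vanishing_left:
  fixes \<beta> :: "real \<Rightarrow> real"
  assumes \<beta>: "continuous_on UNIV \<beta>" "\<And>x. x \<le> 0 \<Longrightarrow> \<beta> x = 0"
  obtains P where "\<And>x. (P has_real_derivative \<beta> x) (at x)" "\<And>x. x \<le> 0 \<Longrightarrow> P x = 0"
proof
  \<comment> \<open>Starting at \<open>-1\<close> makes \<open>0\<close> and every larger
    \<open>x\<close> interior to \<open>{-1..x+1}\<close>, so the derivative is two-sided. For
    \<open>x < -1\<close> the interval is empty and the integral is \<open>0\<close>, as
    required.\<close>
  let ?P = "\<lambda>x. integral {-1..x} \<beta>"
  show zero: "?P x = 0" if "x \<le> 0" for x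
  proof -
    have "integral {-1..x} \<beta> = integral {-1..x} (\<lambda>_. 0)"
      using that by (intro integral_cong \<beta>(2)) auto
    then show ?thesis by simp
  qed
  show "(?P has_real_derivative \<beta> x) (at x)" for x
  proof (cases "x < 0")
    case True
    have "((\<lambda>_. 0) has_real_derivative \<beta> x) (at x)" using \<beta>(2)[of x] True by simp
    then show ?thesis
      by (rule has_field_derivative_transform_within_open[of _ _ _ "{..<0}"]) (use True zero in auto)
  next
    case False
    have "(?P has_vector_derivative \<beta> x) (at x within {-1..x+1})"
      by (rule integral_has_vector_derivative[OF continuous_on_subset[OF \<beta>(1)]]) (use False in auto)
    moreover have "at x within {-1..x+1} = at x" by (rule at_within_Icc_at) (use False in auto)
    ultimately show ?thesis by (simp add: has_real_derivative_iff_has_vector_derivative)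
  qed
qed

text \<open>For interior points \<open>u < v\<close>, the test function is an antiderivative of a
  bump just right of \<open>u\<close> minus the same bump just right of \<open>v\<close>. The
  hypothesis then equates the two weighted averages of \<open>q\<close>, which approximate
  \<open>q u\<close> and \<open>q v\<close> by uniform continuity.\<close>

lemma du_Bois_Reymond:
  fixes q :: "real \<Rightarrow> 'a::banach"
  assumes ab: "a < b" and q: "continuous_on {a..b} q"
    and weak: "\<And>\<phi>. test_function a b \<phi> \<Longrightarrow> integral {a..b} (\<lambda>t. deriv \<phi> t *\<^sub>R q t) = 0"
  shows "q constant_on {a..b}"
proof -
  have eq: "q u = q v" if uv: "a < u" "u < v" "v < b" for u v
  proof -
    have "norm (q u - q v) \<le> 0 + e" if e: "e > 0" for e
    proof -
      obtain d where d: "d > 0" "\<And>x y. x \<in> {a..b} \<Longrightarrow> y \<in> {a..b} \<Longrightarrow> dist y x < d \<Longrightarrow> dist (q y) (q x) < e / 2"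
        using compact_uniformly_continuous[OF q compact_Icc] e unfolding uniformly_continuous_on_def
        by (meson half_gt_zero)
      \<comment> \<open>The bump width lies below the modulus \<open>d\<close> of uniform continuity
        and keeps the support of the bump at \<open>v\<close> inside the open interval.\<close>
      define \<delta> where "\<delta> = min d (b - v) / 2"
      have \<delta>: "\<delta> > 0" "\<delta> < d" "v + \<delta> < b" using d(1) uv by (auto simp: \<delta>_def min_def field_simps)
      define \<beta> where "\<beta> = bump_sum [(0, \<delta>, 1, 1)]"
      have \<beta>_eq: "\<beta> s = (if 0 < s \<and> s < \<delta> then exp (- (1 / s)) * exp (- (1 / (\<delta> - s))) else 0)" for s
        by (simp add: \<beta>_def bump_sum_def poly_exp_def)
      have \<beta>_cont: "continuous_on A \<beta>" for A
        using has_real_derivative_bump_sum unfolding \<beta>_def by (meson DERIV_isCont continuous_at_imp_continuous_on)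
      have \<beta>0: "0 \<le> \<beta> s" for s by (simp add: \<beta>_eq)
      obtain P where P: "\<And>x. (P has_real_derivative \<beta> x) (at x)" "\<And>x. x \<le> 0 \<Longrightarrow> P x = 0"
        by (rule antiderivative_vanishing_left[OF \<beta>_cont[of UNIV]]) (auto simp: \<beta>_eq)
      have P_cont: "continuous_on A P" for A
        by (rule DERIV_continuous_on) (rule has_field_derivative_at_within[OF P(1)])
      have P_const: "P x = P \<delta>" if "\<delta> \<le> x" for x
      proof (cases "x = \<delta>")
        case False
        show ?thesis
        proof (rule DERIV_isconst_end[of \<delta> x P])
          show "\<delta> < x" using that False by simp
          show "continuous_on {\<delta>..x} P" by (rule P_cont)
          show "(P has_real_derivative 0) (at y)" if "\<delta> < y" for y
            using P(1)[of y] that by (simp add: \<beta>_eq)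
        qed
      qed simp
      \<comment> \<open>The total mass of the bump, by which the averages are normalised.\<close>
      define c where "c = P \<delta>"
      have c: "c > 0"
      proof -
        have "P 0 < P \<delta>"
        proof (rule DERIV_pos_imp_increasing_open[OF \<delta>(1) _ P_cont])
          fix x assume "0 < x" "x < \<delta>"
          then have "\<beta> x > 0" by (simp add: \<beta>_eq)
          with P(1) show "\<exists>y. (P has_real_derivative y) (at x) \<and> 0 < y" by blast
        qed
        then show ?thesis using P(2)[of 0] by (simp add: c_def)
      qed
      have P_shift: "((\<lambda>t. P (t - x)) has_real_derivative \<beta> (t - x)) (at t)" for x t
        using P(1)[of "t - x"] DERIV_shift[of P "\<beta> (t - x)" t "- x"] by simp
      have int\<beta>: "((\<lambda>t. \<beta> (t - x)) has_integral c) {a..b}" if "x \<in> {u, v}" for x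
      proof -
        have "((\<lambda>t. \<beta> (t - x)) has_integral (P (b - x) - P (a - x))) {a..b}"
        proof (rule fundamental_theorem_of_calculus[of a b "\<lambda>t. P (t - x)"])
          show "((\<lambda>t. P (t - x)) has_vector_derivative \<beta> (t - x)) (at t within {a..b})" for t
            using P_shift[of x t] has_vector_derivative_at_within
            by (auto simp: has_real_derivative_iff_has_vector_derivative)
        qed (use ab in simp)
        moreover have "P (b - x) = c" using that uv \<delta> by (auto simp: c_def intro!: P_const)
        moreover have "P (a - x) = 0" using that uv by (auto intro!: P(2))
        ultimately show ?thesis by simp
      qed
      have cont: "continuous_on {a..b} (\<lambda>t. \<beta> (t - x) *\<^sub>R q t)" for x
        by (intro continuous_intros q continuous_on_compose2[OF \<beta>_cont[of UNIV]]) auto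
      \<comment> \<open>Left of \<open>u\<close> both terms vanish and right of
        \<open>v + \<delta>\<close> both equal \<open>c\<close>, so the difference has compact
        support although \<open>P\<close> has not.\<close>
      define \<phi> where "\<phi> t = P (t - u) - P (t - v)" for t
      have \<phi>': "(\<phi> has_real_derivative \<beta> (t - u) - \<beta> (t - v)) (at t)" for t
        unfolding \<phi>_def by (intro DERIV_diff P_shift)
      have "test_function a b \<phi>"
      proof (rule test_functionI[of _ "[(u, u + \<delta>, 1, 1), (v, v + \<delta>, - 1, 1)]" u "v + \<delta>"])
        have "bump_sum [(u, u + \<delta>, 1, 1), (v, v + \<delta>, - 1, 1)] x = \<beta> (x - u) - \<beta> (x - v)" for x
          unfolding \<beta>_def bump_sum_def by (simp add: poly_exp_minus algebra_simps)
        then show "(\<phi> has_real_derivative bump_sum [(u, u + \<delta>, 1, 1), (v, v + \<delta>, - 1, 1)] x) (at x)" for x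
          using \<phi>' by simp
        show "\<phi> x = 0" if "x \<notin> {u..v + \<delta>}" for x
        proof (cases "x < u")
          case False
          then have "P (x - u) = P \<delta>" "P (x - v) = P \<delta>" using that uv by (auto intro!: P_const)
          then show ?thesis by (simp add: \<phi>_def)
        qed (use uv in \<open>simp add: \<phi>_def P(2)\<close>)
      qed (use uv \<delta> in auto)
      from weak[OF this] have "integral {a..b} (\<lambda>t. \<beta> (t - u) *\<^sub>R q t - \<beta> (t - v) *\<^sub>R q t) = 0"
        by (simp add: DERIV_imp_deriv[OF \<phi>'] scaleR_diff_left)
      then have same: "integral {a..b} (\<lambda>t. \<beta> (t - u) *\<^sub>R q t) = integral {a..b} (\<lambda>t. \<beta> (t - v) *\<^sub>R q t)"
        by (subst (asm) Henstock_Kurzweil_Integration.integral_diff) (auto intro!: integrable_continuous_real cont)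
      have near: "norm (c *\<^sub>R q x - integral {a..b} (\<lambda>t. \<beta> (t - x) *\<^sub>R q t)) \<le> c * (e / 2)" if x: "x \<in> {u, v}" for x
      proof -
        have I: "((\<lambda>t. \<beta> (t - x) *\<^sub>R q x - \<beta> (t - x) *\<^sub>R q t) has_integral
            (c *\<^sub>R q x - integral {a..b} (\<lambda>t. \<beta> (t - x) *\<^sub>R q t))) {a..b}"
          by (intro has_integral_diff has_integral_scaleR_left int\<beta> x integrable_integral integrable_continuous_real cont)
        have J: "((\<lambda>t. \<beta> (t - x) * (e / 2)) has_integral c * (e / 2)) {a..b}"
          by (intro has_integral_mult_left int\<beta> x)
        have "norm (integral {a..b} (\<lambda>t. \<beta> (t - x) *\<^sub>R q x - \<beta> (t - x) *\<^sub>R q t)) \<le> integral {a..b} (\<lambda>t. \<beta> (t - x) * (e / 2))"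
        proof (rule Henstock_Kurzweil_Integration.integral_norm_bound_integral)
          fix t assume t: "t \<in> {a..b}"
          show "norm (\<beta> (t - x) *\<^sub>R q x - \<beta> (t - x) *\<^sub>R q t) \<le> \<beta> (t - x) * (e / 2)"
          proof (cases "0 < t - x \<and> t - x < \<delta>")
            case True
            then have "dist (q x) (q t) < e / 2" using t x uv \<delta> by (intro d(2)) (auto simp: dist_real_def)
            then have "\<beta> (t - x) * norm (q x - q t) \<le> \<beta> (t - x) * (e / 2)"
              by (intro mult_left_mono \<beta>0) (simp add: dist_norm)
            then show ?thesis using \<beta>0[of "t - x"] by (simp flip: scaleR_diff_right)
          next
            case False
            then have "\<beta> (t - x) = 0" by (auto simp: \<beta>_eq)
            then show ?thesis by simp
          qed
        qed (use I J in auto)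
        then show ?thesis unfolding integral_unique[OF I] integral_unique[OF J] .
      qed
      have split: "c *\<^sub>R (q u - q v) = (c *\<^sub>R q u - integral {a..b} (\<lambda>t. \<beta> (t - u) *\<^sub>R q t))
           - (c *\<^sub>R q v - integral {a..b} (\<lambda>t. \<beta> (t - v) *\<^sub>R q t))"
        using same by (simp add: scaleR_diff_right)
      have "norm (c *\<^sub>R (q u - q v)) \<le> norm (c *\<^sub>R q u - integral {a..b} (\<lambda>t. \<beta> (t - u) *\<^sub>R q t))
           + norm (c *\<^sub>R q v - integral {a..b} (\<lambda>t. \<beta> (t - v) *\<^sub>R q t))"
        unfolding split by (rule norm_triangle_ineq4)
      also have "\<dots> \<le> c * (e / 2) + c * (e / 2)" by (intro add_mono near) auto
      finally have "norm (c *\<^sub>R (q u - q v)) \<le> c * (e / 2) + c * (e / 2)" .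
      then have "c * norm (q u - q v) \<le> c * e" using c by simp
      then show ?thesis using c by simp
    qed
    then have "norm (q u - q v) \<le> 0" by (rule field_le_epsilon)
    then show ?thesis by simp
  qed
  have mid: "q x = q ((a + b) / 2)" if x: "x \<in> {a<..<b}" for x
  proof -
    consider "x < (a + b) / 2" | "x = (a + b) / 2" | "(a + b) / 2 < x" by linarith
    then show ?thesis
    proof cases
      case 1
      show ?thesis by (rule eq) (use 1 x ab in auto)
    next
      case 3
      show ?thesis by (rule eq[symmetric]) (use 3 x ab in auto)
    qed (simp only:)
  qed
  \<comment> \<open>Continuity carries constancy from the open interval to its end points.\<close>
  have cl: "closure {a<..<b} = {a..b}" using ab by simp
  have "q x = q ((a + b) / 2)" if "x \<in> {a..b}" for x
  proof (rule continuous_constant_on_closure[of "{a<..<b}" q])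
    show "continuous_on (closure {a<..<b}) q" unfolding cl by (rule q)
    show "x \<in> closure {a<..<b}" unfolding cl by (rule that)
  qed (rule mid)
  then show ?thesis unfolding constant_on_def by blast
qed


section \<open>From the Caputo derivative to the Abel integral\<close>

lemma test_function_higher_deriv:
  assumes "test_function a b \<phi>"
  shows "((deriv ^^ k) \<phi> has_vector_derivative (deriv ^^ Suc k) \<phi> x) (at x)"
proof -
  have "(deriv ^^ k) \<phi> differentiable (at x)"
    using assms unfolding test_function_def by blast
  then have "((deriv ^^ k) \<phi> has_real_derivative deriv ((deriv ^^ k) \<phi>) x) (at x)"
    by (simp add: DERIV_deriv_iff_real_differentiable)
  then show ?thesis
    by (simp add: has_real_derivative_iff_has_vector_derivative)
qed

lemma continuous_on_test_function_higher_deriv: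
  assumes "test_function a b \<phi>"
  shows "continuous_on A ((deriv ^^ k) \<phi>)"
  by (rule continuous_on_vector_derivative)
    (rule has_vector_derivative_at_within[OF test_function_higher_deriv[OF assms]])

text \<open>The complement of the closed support is open, so every derivative vanishes on it, and it
  contains everything outside \<open>{a<..<b}\<close>. This removes the boundary terms in
  integration by parts.\<close>

lemma test_function_higher_deriv_eq_0:
  assumes \<phi>: "test_function a b \<phi>" and x: "x \<notin> {a<..<b}"
  shows "(deriv ^^ k) \<phi> x = 0"
proof -
  define U where "U = - closure {x. \<phi> x \<noteq> 0}"
  have U: "open U" by (simp add: U_def open_Compl)
  have "\<forall>x\<in>U. (deriv ^^ k) \<phi> x = 0"
  proof (induction k)
    case 0
    show ?case unfolding U_def using closure_subset[of "{x. \<phi> x \<noteq> 0}"] by auto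
  next
    case (Suc k)
    show ?case
    proof
      fix x assume x: "x \<in> U"
      have "((deriv ^^ k) \<phi> has_real_derivative 0) (at x)"
        by (rule has_field_derivative_transform_within_open[OF DERIV_const U x]) (use Suc in simp)
      then show "(deriv ^^ Suc k) \<phi> x = 0" by (simp add: DERIV_imp_deriv)
    qed
  qed
  moreover have "x \<in> U" using \<phi> x unfolding U_def test_function_def by blast
  ultimately show ?thesis by blast
qed

lemma integral_test_function_by_parts:
  fixes u :: "real \<Rightarrow> 'a::banach"
  assumes ab: "a < b" and \<phi>: "test_function a b \<phi>"
    and u: "\<And>t. t \<in> {a..b} \<Longrightarrow> (u has_vector_derivative u' t) (at t within {a..b})"
    and u': "continuous_on {a..b} u'"
  shows "integral {a..b} (\<lambda>t. (deriv ^^ Suc k) \<phi> t *\<^sub>R u t) = - integral {a..b} (\<lambda>t. (deriv ^^ k) \<phi> t *\<^sub>R u' t)"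
proof -
  have uc: "continuous_on {a..b} u" using u by (rule continuous_on_vector_derivative)
  note \<phi>c = continuous_on_test_function_higher_deriv[OF \<phi>]
  have "((\<lambda>t. (deriv ^^ k) \<phi> t *\<^sub>R u' t + (deriv ^^ Suc k) \<phi> t *\<^sub>R u t) has_integral
     ((deriv ^^ k) \<phi> b *\<^sub>R u b - (deriv ^^ k) \<phi> a *\<^sub>R u a)) {a..b}"
  proof (rule fundamental_theorem_of_calculus[where f="\<lambda>t. (deriv ^^ k) \<phi> t *\<^sub>R u t"])
    show "((\<lambda>t. (deriv ^^ k) \<phi> t *\<^sub>R u t) has_vector_derivative
        (deriv ^^ k) \<phi> t *\<^sub>R u' t + (deriv ^^ Suc k) \<phi> t *\<^sub>R u t) (at t within {a..b})" if "t \<in> {a..b}" for t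
      by (rule bounded_bilinear.has_vector_derivative[OF bounded_bilinear_scaleR
            has_vector_derivative_at_within[OF test_function_higher_deriv[OF \<phi>]] u[OF that]])
  qed (use ab in simp)
  then have "integral {a..b} (\<lambda>t. (deriv ^^ k) \<phi> t *\<^sub>R u' t + (deriv ^^ Suc k) \<phi> t *\<^sub>R u t) = 0"
    using test_function_higher_deriv_eq_0[OF \<phi>] by (simp add: integral_unique del: funpow.simps)
  then have "integral {a..b} (\<lambda>t. (deriv ^^ k) \<phi> t *\<^sub>R u' t) + integral {a..b} (\<lambda>t. (deriv ^^ Suc k) \<phi> t *\<^sub>R u t) = 0"
    by (subst (asm) Henstock_Kurzweil_Integration.integral_add)
       (intro integrable_continuous_real continuous_on_scaleR uc u' \<phi>c | simp only:)+
  then show ?thesis by (simp add: add_eq_0_iff del: funpow.simps)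
qed

lemma integral_test_function_by_parts_iterated:
  fixes u :: "nat \<Rightarrow> real \<Rightarrow> 'a::banach"
  assumes ab: "a < b" and \<phi>: "test_function a b \<phi>"
    and u: "\<And>j t. j < n \<Longrightarrow> t \<in> {a..b} \<Longrightarrow> (u j has_vector_derivative u (Suc j) t) (at t within {a..b})"
    and un: "continuous_on {a..b} (u n)"
  shows "integral {a..b} (\<lambda>t. (deriv ^^ (n + k)) \<phi> t *\<^sub>R u 0 t) =
      (- 1) ^ n *\<^sub>R integral {a..b} (\<lambda>t. (deriv ^^ k) \<phi> t *\<^sub>R u n t)"
  using u un
\<comment> \<open>The induction hypothesis is applied at \<open>Suc k\<close>: one derivative
  remains on the test function and is moved to \<open>u n\<close> last.\<close>
proof (induction n arbitrary: k)
  case (Suc n)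
  have un: "continuous_on {a..b} (u n)"
    by (rule continuous_on_vector_derivative[OF Suc.prems(1)]) simp
  have "integral {a..b} (\<lambda>t. (deriv ^^ (n + Suc k)) \<phi> t *\<^sub>R u 0 t) =
      (- 1) ^ n *\<^sub>R integral {a..b} (\<lambda>t. (deriv ^^ Suc k) \<phi> t *\<^sub>R u n t)"
    by (rule Suc.IH) (use Suc.prems un in auto)
  also have "integral {a..b} (\<lambda>t. (deriv ^^ Suc k) \<phi> t *\<^sub>R u n t) = - integral {a..b} (\<lambda>t. (deriv ^^ k) \<phi> t *\<^sub>R u (Suc n) t)"
    by (rule integral_test_function_by_parts[OF ab \<phi> Suc.prems]) auto
  finally show ?case by (simp del: funpow.simps)
qed simp

text \<open>Turns the pairings in the definition of the weak derivative into integrals over the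
  closed interval, where the fundamental theorem is available.\<close>

lemma bochner_integral_test_function:
  fixes u :: "real \<Rightarrow> 'a::banach"
  assumes "test_function a b \<phi>" "continuous_on {a..b} u"
  shows "bochner_integral (lebesgue_on {a<..<b}) (\<lambda>t. (deriv ^^ k) \<phi> t *\<^sub>R u t) =
         integral {a..b} (\<lambda>t. (deriv ^^ k) \<phi> t *\<^sub>R u t)"
proof -
  have "integrable (lebesgue_on {a..b}) ((deriv ^^ k) \<phi>)"
    by (intro continuous_imp_integrable_real continuous_on_test_function_higher_deriv[OF assms(1)])
  then have "(deriv ^^ k) \<phi> absolutely_integrable_on {a..b}"
    by (simp add: set_integrable_def integrable_restrict_space)
  then have "(deriv ^^ k) \<phi> absolutely_integrable_on {a<..<b}"
    by (rule set_integrable_subset) auto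
  then have "integrable (lebesgue_on {a<..<b}) ((deriv ^^ k) \<phi>)"
    by (rule absolutely_integrable_imp_integrable) simp
  from bochner_integral_eq_integral(2)[OF _ _ this assms(2)] show ?thesis
    by (simp add: integral_open_interval_real less_imp_le subset_iff)
qed

text \<open>Moving \<open>n\<close> derivatives from the test function to the classical derivatives
  of \<open>u 0\<close> shows that \<open>g\<close> is the first weak derivative of
  \<open>u n\<close>. The lemma of du Bois-Reymond then applies to \<open>u n\<close> minus the
  primitive \<open>G\<close> of \<open>g\<close>.\<close>

lemma has_weak_deriv_imp_integral:
  fixes u :: "nat \<Rightarrow> real \<Rightarrow> 'a::banach"
  assumes ab: "a < b"
    and weak: "has_weak_deriv (Suc n) a b U g" and g: "continuous_on {a..b} g"
    and U: "\<And>t. t \<in> {a..b} \<Longrightarrow> U t = u 0 t"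
    and u: "\<And>j t. j < n \<Longrightarrow> t \<in> {a..b} \<Longrightarrow> (u j has_vector_derivative u (Suc j) t) (at t within {a..b})"
    and un: "continuous_on {a..b} (u n)"
    and t: "t \<in> {a..b}"
  shows "u n t = u n a + integral {a..t} g"
proof -
  define G where "G t = integral {a..t} g" for t
  have G: "(G has_vector_derivative g t) (at t within {a..b})" if "t \<in> {a..b}" for t
    unfolding G_def using g that by (rule integral_has_vector_derivative)
  then have Gc: "continuous_on {a..b} G" by (rule continuous_on_vector_derivative)
  have u0: "continuous_on {a..b} (u 0)"
  proof (cases "n = 0")
    case False
    then show ?thesis using u by (intro continuous_on_vector_derivative[of _ "u 0" "u (Suc 0)"]) simp
  qed (use un in simp)
  have Uc: "continuous_on {a..b} U"
    by (rule iffD2[OF continuous_on_cong[OF refl U] u0])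
  have "(\<lambda>t. u n t - G t) constant_on {a..b}"
  proof (rule du_Bois_Reymond[OF ab])
    show "continuous_on {a..b} (\<lambda>t. u n t - G t)" by (intro continuous_intros un Gc)
    fix \<phi> assume \<phi>: "test_function a b \<phi>"
    note \<phi>c = continuous_on_test_function_higher_deriv[OF \<phi>]
    have "(- 1) ^ n *\<^sub>R integral {a..b} (\<lambda>t. (deriv ^^ Suc 0) \<phi> t *\<^sub>R u n t) =
        integral {a..b} (\<lambda>t. (deriv ^^ (n + Suc 0)) \<phi> t *\<^sub>R u 0 t)"
      by (rule integral_test_function_by_parts_iterated[OF ab \<phi> u un, symmetric])
    also have "\<dots> = integral {a..b} (\<lambda>t. (deriv ^^ (n + Suc 0)) \<phi> t *\<^sub>R U t)"
      using U by (intro integral_cong) simp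
    also have "\<dots> = bochner_integral (lebesgue_on {a<..<b}) (\<lambda>t. (deriv ^^ Suc n) \<phi> t *\<^sub>R U t)"
      using bochner_integral_test_function[OF \<phi> Uc, of "Suc n"] by simp
    \<comment> \<open>The test function is written as its own derivative of order \<open>0\<close>,
      so that the same conversion and integration by parts lemmas apply. The surplus sign is
      absorbed by moving a derivative onto \<open>G\<close>.\<close>
    also have "\<dots> = (- 1) ^ Suc n *\<^sub>R bochner_integral (lebesgue_on {a<..<b}) (\<lambda>t. (deriv ^^ 0) \<phi> t *\<^sub>R g t)"
      using weak \<phi> unfolding has_weak_deriv_def by (simp del: funpow.simps(2))
    also have "\<dots> = (- 1) ^ n *\<^sub>R - integral {a..b} (\<lambda>t. (deriv ^^ 0) \<phi> t *\<^sub>R g t)"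
      unfolding bochner_integral_test_function[OF \<phi> g] by simp
    also have "- integral {a..b} (\<lambda>t. (deriv ^^ 0) \<phi> t *\<^sub>R g t) = integral {a..b} (\<lambda>t. (deriv ^^ Suc 0) \<phi> t *\<^sub>R G t)"
      by (rule integral_test_function_by_parts[OF ab \<phi> G g, symmetric])
    finally have eq: "integral {a..b} (\<lambda>t. deriv \<phi> t *\<^sub>R u n t) = integral {a..b} (\<lambda>t. deriv \<phi> t *\<^sub>R G t)"
      by simp
    have "(\<lambda>t. deriv \<phi> t *\<^sub>R v t) integrable_on {a..b}" if "continuous_on {a..b} v" for v :: "real \<Rightarrow> 'a"
      using \<phi>c[of _ 1] that by (intro integrable_continuous_real continuous_on_scaleR) auto
    then show "integral {a..b} (\<lambda>t. deriv \<phi> t *\<^sub>R (u n t - G t)) = 0"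
      using eq un Gc by (simp add: scaleR_diff_right Henstock_Kurzweil_Integration.integral_diff)
  qed
  then have "u n t - G t = u n a - G a"
    using t ab unfolding constant_on_def by force
  then show ?thesis by (simp add: G_def algebra_simps)
qed

section \<open>Taylor remainders\<close>

text \<open>The Taylor remainders of the successive derivatives of \<open>f\<close> at the left end point;
  the one with \<open>j = 0\<close> is the function whose Riemann--Liouville derivative is the Caputo derivative.\<close>

definition Taylor_remainder :: "nat \<Rightarrow> real \<Rightarrow> real \<Rightarrow> (real \<Rightarrow> 'a::real_normed_vector) \<Rightarrow> nat \<Rightarrow> real \<Rightarrow> 'a" where
  "Taylor_remainder n a b f j t =
     iter_deriv a b j f t - (\<Sum>i<Suc n - j. ((t - a) ^ i / fact i) *\<^sub>R iter_deriv a b (j + i) f a)"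

lemma Taylor_remainder_at_left: "j \<le> n \<Longrightarrow> Taylor_remainder n a b f j a = 0"
  by (simp add: Taylor_remainder_def Suc_diff_le sum.lessThan_Suc_shift del: sum.lessThan_Suc)

lemma Taylor_remainder_last: "Taylor_remainder n a b f n t = iter_deriv a b n f t - iter_deriv a b n f a"
  by (simp add: Taylor_remainder_def)

text \<open>Differentiation kills the constant term of the Taylor polynomial and shifts the others
  down by one index, giving the polynomial of the next derivative with one term fewer.\<close>

lemma Taylor_remainder_has_vector_derivative:
  assumes f: "f \<in> C_space n a b" and j: "j < n" and t: "t \<in> {a..b}"
  shows "(Taylor_remainder n a b f j has_vector_derivative Taylor_remainder n a b f (Suc j) t) (at t within {a..b})"
proof -
  have "iter_deriv a b j f differentiable (at t within {a..b})"
    using f j t unfolding C_space_def by blast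
  then have f': "(iter_deriv a b j f has_vector_derivative iter_deriv a b (Suc j) f t) (at t within {a..b})"
    by (simp add: vector_derivative_works iter_deriv_def)
  have pw: "((\<lambda>t. (t - a) ^ Suc i / fact (Suc i)) has_real_derivative (t - a) ^ i / fact i) (at t within {a..b})" for i
  proof -
    have "((\<lambda>t. t - a) has_real_derivative 1 - 0) (at t within {a..b})"
      by (intro DERIV_diff DERIV_ident DERIV_const)
    then have "((\<lambda>t. (t - a) ^ Suc i / fact (Suc i)) has_real_derivative
        (1 + real i) * ((1 - 0) * (t - a) ^ i) / fact (Suc i)) (at t within {a..b})"
      by (intro DERIV_cdivide DERIV_power_Suc)
    moreover have "(1 + real i) * ((1 - 0) * (t - a) ^ i) / fact (Suc i) = (t - a) ^ i / fact i"
      by simp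
    ultimately show ?thesis by simp
  qed
  have "((\<lambda>t. \<Sum>i<n - j. ((t - a) ^ Suc i / fact (Suc i)) *\<^sub>R iter_deriv a b (j + Suc i) f a) has_vector_derivative
      (\<Sum>i<n - j. ((t - a) ^ i / fact i) *\<^sub>R iter_deriv a b (Suc j + i) f a)) (at t within {a..b})"
    using has_vector_derivative_scaleR[OF pw has_vector_derivative_const]
    by (intro has_vector_derivative_sum) fastforce
  from has_vector_derivative_diff[OF f' has_vector_derivative_add[OF has_vector_derivative_const[of "iter_deriv a b j f a"] this]]
  show ?thesis
    using j by (simp add: Taylor_remainder_def[abs_def] Suc_diff_le sum.lessThan_Suc_shift del: sum.lessThan_Suc)
qed

lemma continuous_on_Taylor_remainder:
  assumes f: "f \<in> C_space n a b" and j: "j \<le> n"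
  shows "continuous_on {a..b} (Taylor_remainder n a b f j)"
proof (cases "j = n")
  case True
  have "continuous_on {a..b} (iter_deriv a b n f)" using f by (simp add: C_space_def)
  then have "continuous_on {a..b} (\<lambda>t. iter_deriv a b n f t - iter_deriv a b n f a)"
    by (intro continuous_intros)
  then show ?thesis
    unfolding True by (simp add: Taylor_remainder_last cong: continuous_on_cong)
next
  case False
  then show ?thesis
    using j by (intro continuous_on_vector_derivative[OF Taylor_remainder_has_vector_derivative[OF f]]) auto
qed

text \<open>The fundamental theorem without boundary term, as the remainder vanishes at
  \<open>a\<close>. In this form the relation can be commuted with a fractional integral.\<close>

lemma Taylor_remainder_eq_integral:
  fixes f :: "real \<Rightarrow> 'a::banach"
  assumes f: "f \<in> C_space n a b" and j: "j < n" and t: "t \<in> {a..b}"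
  shows "Taylor_remainder n a b f j t = Abel_integral a 1 (Taylor_remainder n a b f (Suc j)) t"
proof -
  have "(Taylor_remainder n a b f (Suc j) has_integral
      (Taylor_remainder n a b f j t - Taylor_remainder n a b f j a)) {a..t}"
    by (rule fundamental_theorem_of_calculus)
       (use t in \<open>auto intro: has_vector_derivative_within_subset[OF Taylor_remainder_has_vector_derivative[OF f j]]\<close>)
  then show ?thesis
    using j by (simp add: Abel_integral_one integral_unique Taylor_remainder_at_left)
qed

section \<open>Inversion of the fractional integral\<close>

lemma Abel_integral_one_inject:
  fixes f g :: "real \<Rightarrow> 'a::banach"
  assumes ab: "a < b" and f: "continuous_on {a..b} f" and g: "continuous_on {a..b} g"
    and eq: "\<And>t. t \<in> {a..b} \<Longrightarrow> Abel_integral a 1 f t = Abel_integral a 1 g t" and t: "t \<in> {a..b}"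
  shows "f t = g t"
proof (rule vector_derivative_unique_within_closed_interval[of a b t "\<lambda>t. integral {a..t} f"])
  show "((\<lambda>t. integral {a..t} f) has_vector_derivative f t) (at t within cbox a b)"
    using integral_has_vector_derivative[OF f t] by simp
  have "((\<lambda>t. integral {a..t} g) has_vector_derivative g t) (at t within cbox a b)"
    using integral_has_vector_derivative[OF g t] by simp
  then show "((\<lambda>t. integral {a..t} f) has_vector_derivative g t) (at t within cbox a b)"
    by (rule has_vector_derivative_transform[rotated 2]) (use eq t in \<open>auto simp: Abel_integral_one\<close>)
qed (use ab t in auto)

lemma RL_integral_eq_Abel_integral:
  fixes f :: "real \<Rightarrow> 'a::banach"
  assumes "0 < \<beta>" "continuous_on {a..t} f"
  shows "RL_integral a \<beta> f t = (1 / Gamma \<beta>) *\<^sub>R Abel_integral a \<beta> f t"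
proof -
  have "bochner_integral (lebesgue_on {a..t}) (\<lambda>s. (t - s) powr (\<beta> - 1) *\<^sub>R f s) = Abel_integral a \<beta> f t"
    unfolding Abel_integral_def
    by (rule bochner_integral_eq_integral(2)[OF _ _ integrable_powr_kernel[OF assms(1) order_refl] assms(2)]) auto
  then show ?thesis using assms(1) by (simp add: RL_integral_def)
qed

text \<open>The constant \<open>c\<close> is \<open>1 / Gamma \<alpha>\<close> in either case, but a
  Hoelder estimate only requires that some constant exists.\<close>

proposition Caputo_deriv_imp_Abel_integral:
  fixes f :: "real \<Rightarrow> 'a::banach"
  assumes ab: "a < b" and \<alpha>: "0 < \<alpha>" "\<alpha> \<le> 1"
    and f: "f \<in> C_space n a b" and g: "continuous_on {a..b} g"
    and Caputo: "has_Caputo_deriv (real n + \<alpha>) a b f g"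
  obtains c where "\<And>t. t \<in> {a..b} \<Longrightarrow> iter_deriv a b n f t - iter_deriv a b n f a = c *\<^sub>R Abel_integral a \<alpha> g t"
proof -
  let ?h = "Taylor_remainder n a b f"
  \<comment> \<open>The ceiling is \<open>n + 1\<close> also for \<open>\<alpha> = 1\<close>, when
    the inner fractional integral has order \<open>0\<close>.\<close>
  have ceil: "\<lceil>real n + \<alpha>\<rceil> = int n + 1" using \<alpha> by (simp add: ceiling_eq_iff)
  then have nat_ceil: "nat \<lceil>real n + \<alpha>\<rceil> = Suc n" by simp
  have order: "of_int \<lceil>real n + \<alpha>\<rceil> - (real n + \<alpha>) = 1 - \<alpha>" using ceil by simp
  have h0: "(\<lambda>t. f t - (\<Sum>j<nat \<lceil>real n + \<alpha>\<rceil>. ((t - a) ^ j / fact j) *\<^sub>R iter_deriv a b j f a)) = ?h 0"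
    unfolding nat_ceil Taylor_remainder_def[abs_def] by (simp add: iter_deriv_def del: sum.lessThan_Suc)
  have weak: "has_weak_deriv (Suc n) a b (RL_integral a (1 - \<alpha>) (?h 0)) g"
    using Caputo unfolding has_Caputo_deriv_def has_RL_deriv_def h0 order unfolding nat_ceil .
  have hc: "continuous_on {a..t} (?h j)" if "j \<le> n" "t \<le> b" for j t
    using continuous_on_Taylor_remainder[OF f that(1)] that(2) by (elim continuous_on_subset) auto
  have gc: "continuous_on {a..t} g" if "t \<le> b" for t
    using g that by (elim continuous_on_subset) auto
  show ?thesis
  proof (cases "\<alpha> = 1")
    \<comment> \<open>Here \<open>RL_integral\<close> of order \<open>0\<close> is the identity by
      definition, so the weak derivative is that of the remainder itself.\<close>
    case True
    have "?h n t = 1 *\<^sub>R Abel_integral a \<alpha> g t" if t: "t \<in> {a..b}" for t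
    proof -
      have "?h n t = ?h n a + integral {a..t} g"
        by (rule has_weak_deriv_imp_integral[OF ab weak g])
           (use t True hc in \<open>auto simp: RL_integral_def intro: Taylor_remainder_has_vector_derivative[OF f]\<close>)
      then show ?thesis using True by (simp add: Taylor_remainder_at_left Abel_integral_one)
    qed
    then show ?thesis using that unfolding Taylor_remainder_last by blast
  next
    case False
    define \<beta> where "\<beta> = 1 - \<alpha>"
    have \<beta>: "0 < \<beta>" "\<beta> \<le> 1" using \<alpha> False by (auto simp: \<beta>_def)
    have G0: "Gamma \<beta> > 0" using \<beta> by (simp add: Gamma_real_pos)
    define u where "u j t = (1 / Gamma \<beta>) *\<^sub>R Abel_integral a \<beta> (?h j) t" for j t
    have Ac: "continuous_on {a..b} (Abel_integral a \<beta> (?h j))" if "j \<le> n" for j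
      using that by (intro continuous_on_Abel_integral \<beta> hc) auto
    \<comment> \<open>The remainder is the integral of the next one, and the Abel integral of order
      \<beta> commutes with integration; hence the Abel integrals inherit the chain of
      derivatives.\<close>
    have u': "(u j has_vector_derivative u (Suc j) t) (at t within {a..b})" if j: "j < n" and t: "t \<in> {a..b}" for j t
    proof -
      have "Abel_integral a \<beta> (?h j) s = integral {a..s} (Abel_integral a \<beta> (?h (Suc j)))" if s: "s \<in> {a..b}" for s
      proof -
        have "Abel_integral a \<beta> (?h j) s = Abel_integral a \<beta> (Abel_integral a 1 (?h (Suc j))) s"
          using s by (intro Abel_integral_cong Taylor_remainder_eq_integral f j) auto
        also have "\<dots> = Abel_integral a 1 (Abel_integral a \<beta> (?h (Suc j))) s"
          using s j \<beta> by (intro Abel_integral_commute hc) auto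
        finally show ?thesis by (simp add: Abel_integral_one)
      qed
      moreover have "((\<lambda>s. integral {a..s} (Abel_integral a \<beta> (?h (Suc j)))) has_vector_derivative
          Abel_integral a \<beta> (?h (Suc j)) t) (at t within {a..b})"
        using j t by (intro integral_has_vector_derivative Ac) auto
      ultimately have "(Abel_integral a \<beta> (?h j) has_vector_derivative Abel_integral a \<beta> (?h (Suc j)) t) (at t within {a..b})"
        using t by (auto intro: has_vector_derivative_transform)
      then show ?thesis
        unfolding u_def by (intro has_vector_derivative_scaleR[OF DERIV_const, THEN has_vector_derivative_eq_rhs]) auto
    qed
    have un: "continuous_on {a..b} (u n)"
      unfolding u_def by (intro continuous_intros Ac) simp
    have U: "RL_integral a (1 - \<alpha>) (?h 0) t = u 0 t" if "t \<in> {a..b}" for t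
      using that unfolding u_def \<beta>_def[symmetric] by (intro RL_integral_eq_Abel_integral \<beta> hc) auto
    have v: "Abel_integral a \<beta> (?h n) t = Gamma \<beta> *\<^sub>R Abel_integral a 1 g t" if t: "t \<in> {a..b}" for t
    proof -
      \<comment> \<open>The value \<open>u n a\<close> is \<open>0\<close>, being an Abel integral
        over a single point.\<close>
      have "u n t = u n a + integral {a..t} g"
        by (rule has_weak_deriv_imp_integral[OF ab weak g U u' un t])
      then have "Gamma \<beta> *\<^sub>R (1 / Gamma \<beta>) *\<^sub>R Abel_integral a \<beta> (?h n) t = Gamma \<beta> *\<^sub>R Abel_integral a 1 g t"
        by (simp add: u_def Abel_integral_one)
      then show ?thesis using G0 by simp
    qed
    have sum1: "\<alpha> + \<beta> = 1" by (simp add: \<beta>_def)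
    then have B: "Beta \<alpha> \<beta> \<noteq> 0" using Gamma_real_pos[OF \<alpha>(1)] G0 by (simp add: Beta_def)
    have "?h n t = (Gamma \<beta> / Beta \<alpha> \<beta>) *\<^sub>R Abel_integral a \<alpha> g t" if t: "t \<in> {a..b}" for t
    proof (rule Abel_integral_one_inject[OF ab _ _ _ t])
      show "continuous_on {a..b} (?h n)" by (rule hc) auto
      show "continuous_on {a..b} (\<lambda>t. (Gamma \<beta> / Beta \<alpha> \<beta>) *\<^sub>R Abel_integral a \<alpha> g t)"
        by (intro continuous_intros continuous_on_Abel_integral \<alpha> g)
      fix s assume s: "s \<in> {a..b}"
      \<comment> \<open>Applying the Abel integral of order \<alpha> brings the total order to
        \<open>\<alpha> + \<beta> = 1\<close>, where differentiation recovers the function.\<close>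
      have "Beta \<alpha> \<beta> *\<^sub>R Abel_integral a 1 (?h n) s = Abel_integral a \<alpha> (Abel_integral a \<beta> (?h n)) s"
        using s \<alpha> \<beta> by (subst Abel_integral_Abel_integral) (auto intro: hc simp: sum1)
      also have "\<dots> = Abel_integral a \<alpha> (\<lambda>t. Gamma \<beta> *\<^sub>R Abel_integral a 1 g t) s"
        using s by (intro Abel_integral_cong v) auto
      also have "\<dots> = Gamma \<beta> *\<^sub>R Abel_integral a 1 (Abel_integral a \<alpha> g) s"
        using s \<alpha> by (simp add: Abel_integral_scaleR Abel_integral_commute[of \<alpha> 1] gc)
      finally have "(1 / Beta \<alpha> \<beta>) *\<^sub>R Beta \<alpha> \<beta> *\<^sub>R Abel_integral a 1 (?h n) s =
          (1 / Beta \<alpha> \<beta>) *\<^sub>R Gamma \<beta> *\<^sub>R Abel_integral a 1 (Abel_integral a \<alpha> g) s" by simp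
      then show "Abel_integral a 1 (?h n) s = Abel_integral a 1 (\<lambda>t. (Gamma \<beta> / Beta \<alpha> \<beta>) *\<^sub>R Abel_integral a \<alpha> g t) s"
        using B by (simp add: Abel_integral_scaleR)
    qed
    then show ?thesis using that unfolding Taylor_remainder_last by blast
  qed
qed

section \<open>The embedding into the Hoelder space\<close>

theorem corollary23:
  fixes t0 t1 \<alpha> :: real and n :: nat
  assumes "t0 < t1" and "0 < \<alpha>" and "\<alpha> \<le> 1"
  shows "(frac_C_space (real n + \<alpha>) t0 t1 :: (real \<Rightarrow> 'a::banach) set)
           \<subseteq> Hoelder_space n \<alpha> t0 t1"
proof
  fix f :: "real \<Rightarrow> 'a" assume F: "f \<in> frac_C_space (real n + \<alpha>) t0 t1"
  have "\<lceil>real n + \<alpha>\<rceil> = int n + 1" using assms by (simp add: ceiling_eq_iff)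
  then have "nat \<lceil>real n + \<alpha>\<rceil> - 1 = n" by simp
  with F obtain g where f: "f \<in> C_space n t0 t1" and g: "continuous_on {t0..t1} g"
    and Caputo: "has_Caputo_deriv (real n + \<alpha>) t0 t1 f g"
    unfolding frac_C_space_def by auto
  obtain c where c: "\<And>t. t \<in> {t0..t1} \<Longrightarrow>
      iter_deriv t0 t1 n f t - iter_deriv t0 t1 n f t0 = c *\<^sub>R Abel_integral t0 \<alpha> g t"
    using Caputo_deriv_imp_Abel_integral[OF assms f g Caputo] by blast
  obtain C where C: "C > 0" "\<And>s t. s \<in> {t0..t1} \<Longrightarrow> t \<in> {t0..t1} \<Longrightarrow>
      norm (Abel_integral t0 \<alpha> g t - Abel_integral t0 \<alpha> g s) \<le> C * \<bar>t - s\<bar> powr \<alpha>"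
    using Abel_integral_bounded_Hoelder[OF assms(2,3) g] by blast
  \<comment> \<open>The Hoelder constant must be positive; \<open>\<bar>c\<bar> + 1\<close> ensures
    this even if \<open>c = 0\<close>.\<close>
  have "norm (iter_deriv t0 t1 n f t - iter_deriv t0 t1 n f s) \<le> ((\<bar>c\<bar> + 1) * C) * \<bar>t - s\<bar> powr \<alpha>"
    if "t \<in> {t0..t1}" "s \<in> {t0..t1}" for s t
  proof -
    have "iter_deriv t0 t1 n f t - iter_deriv t0 t1 n f s =
        c *\<^sub>R (Abel_integral t0 \<alpha> g t - Abel_integral t0 \<alpha> g s)"
      using c[OF that(1)] c[OF that(2)] by (simp add: scaleR_diff_right algebra_simps)
    then have "norm (iter_deriv t0 t1 n f t - iter_deriv t0 t1 n f s) =
        \<bar>c\<bar> * norm (Abel_integral t0 \<alpha> g t - Abel_integral t0 \<alpha> g s)" by simp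
    also have "\<dots> \<le> (\<bar>c\<bar> + 1) * (C * \<bar>t - s\<bar> powr \<alpha>)"
      by (intro mult_mono C that) auto
    finally show ?thesis by (simp add: mult.assoc)
  qed
  with f C(1) show "f \<in> Hoelder_space n \<alpha> t0 t1"
    unfolding Hoelder_space_def by (auto intro!: exI[of _ "(\<bar>c\<bar> + 1) * C"])
qed

end
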